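(* There is a polynomial-time algorithm that, given $C,C'\in\mathcal{L}(\geq,\sqcap,\top)$, decides whether $\models C\sqsubseteq C'$.
   Context: $\mathcal{L}(\geq,\sqcap,\top)$ is the set of concepts $C ::= A\mid\top\mid C\sqcap C\mid (\geq k\,R.C)$ with $A$ a concept name, $R$ a role name, $k\ge 1$ (numbers written in binary), interpreted in the standard way: $(\geq k\,R.C)^{\mathcal I}$ is the set of elements with at least $k$ pairwise distinct $R$-successors in $C^{\mathcal I}$. $\models C\sqsubseteq C'$ means $C^{\mathcal I}\subseteq C'^{\mathcal I}$ in every interpretation $\mathcal I$. Running time is measured in $|C|+|C'|$, the number of symbols. *)

theory Defs
  imports "HOL-Computational_Algebra.Polynomial" "HOL-Library.Countable_Set"
begin

section \<open>Syntax and semantics\<close>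

text \<open>Concept names and role names are the members of two countably infinite sets, indexed by binary
  words.  Number restrictions use the type \<^typ>\<open>num\<close> of binary numerals, whose values are
  exactly the integers \<open>k \<ge> 1\<close>.\<close>

type_synonym name = "bool list"

datatype concept =
    Atom name
  | Top
  | And concept concept
  | AtLeast num name concept

record 'd interp =
  domain :: "'d set"
  conc :: "name \<Rightarrow> 'd set"
  role :: "name \<Rightarrow> ('d \<times> 'd) set"

definition is_interp :: "'d interp \<Rightarrow> bool" where
  "is_interp I \<longleftrightarrow> domain I \<noteq> {} \<and> (\<forall>A. conc I A \<subseteq> domain I) \<and>
     (\<forall>R. role I R \<subseteq> domain I \<times> domain I)"

primrec extension :: "'d interp \<Rightarrow> concept \<Rightarrow> 'd set" where
  "extension I (Atom A) = conc I A"
| "extension I Top = domain I"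
| "extension I (And C D) = extension I C \<inter> extension I D"
| "extension I (AtLeast k R C) =
     {x \<in> domain I. \<exists>S. S \<subseteq> {y. (x, y) \<in> role I R \<and> y \<in> extension I C} \<and> finite S \<and> card S = numeral k}"

text \<open>A formula cannot quantify over all types, so the domains range over the nonempty sets of
  natural numbers.  This is no restriction: by \<open>subsumed_iff\<close> below, interpretations over any
  other infinite type give the same relation, and by \<open>subsumed_extension\<close> a subsumption that holds
  here holds in the interpretations over every type.\<close>

definition subsumed :: "concept \<Rightarrow> concept \<Rightarrow> bool" where
  "subsumed C D \<longleftrightarrow> (\<forall>I :: nat interp. is_interp I \<longrightarrow> extension I C \<subseteq> extension I D)"

instance num :: countable by countable_datatype
instance concept :: countable by countable_datatype

lemma extension_transfer:
  fixes I :: "'d interp" and f :: "'d \<Rightarrow> 'e"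
  assumes I: "is_interp I" and S: "S \<subseteq> domain I" and inj: "inj_on f S"
    and closed: "\<And>x k R C. x \<in> S \<Longrightarrow> x \<in> extension I (AtLeast k R C) \<Longrightarrow>
      \<exists>T\<subseteq>S. T \<subseteq> {y. (x, y) \<in> role I R \<and> y \<in> extension I C} \<and> finite T \<and> card T = numeral k"
  defines "J \<equiv> \<lparr>domain = f ` S, conc = (\<lambda>A. f ` (conc I A \<inter> S)),
                role = (\<lambda>R. map_prod f f ` (role I R \<inter> S \<times> S))\<rparr>"
  shows "extension J C = f ` (extension I C \<inter> S)"
proof (induction C)
  case (Atom A)
  show ?case by (simp add: J_def)
next
  case Top
  show ?case using S by (simp add: J_def Int_absorb1)
next
  case (And C D)
  have "f ` (extension I C \<inter> S) \<inter> f ` (extension I D \<inter> S)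
      = f ` ((extension I C \<inter> S) \<inter> (extension I D \<inter> S))"
    using inj_on_image_Int[OF inj, of "extension I C \<inter> S" "extension I D \<inter> S"] by simp
  then show ?case using And by (simp add: Int_ac)
next
  case (AtLeast k R C)
  have succ: "{z. (f x, z) \<in> role J R \<and> z \<in> extension J C} =
      f ` ({y. (x, y) \<in> role I R \<and> y \<in> extension I C} \<inter> S)" if "x \<in> S" for x
  proof -
    have role: "(f x, z) \<in> role J R \<longleftrightarrow> (\<exists>y\<in>S. z = f y \<and> (x, y) \<in> role I R)" for z
    proof
      assume "(f x, z) \<in> role J R"
      then obtain u v where uv: "(u, v) \<in> role I R" "u \<in> S" "v \<in> S" "f x = f u" "z = f v"
        by (auto simp: J_def)
      then have "u = x" using inj_onD[OF inj] that by metis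
      then show "\<exists>y\<in>S. z = f y \<and> (x, y) \<in> role I R" using uv by blast
    next
      assume "\<exists>y\<in>S. z = f y \<and> (x, y) \<in> role I R"
      then obtain y where y: "y \<in> S" "z = f y" "(x, y) \<in> role I R" by blast
      then have "(x, y) \<in> role I R \<inter> S \<times> S" using that by blast
      then have "map_prod f f (x, y) \<in> role J R" unfolding J_def by (simp only: interp.simps imageI)
      then show "(f x, z) \<in> role J R" using y by simp
    qed
    have ext: "f y \<in> extension J C \<longleftrightarrow> y \<in> extension I C" if "y \<in> S" for y
      using that inj_onD[OF inj] unfolding AtLeast by blast
    show ?thesis unfolding role using ext by blast
  qed
  have "f x \<in> extension J (AtLeast k R C) \<longleftrightarrow> x \<in> extension I (AtLeast k R C)" if x: "x \<in> S" for x
  proof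
    assume "f x \<in> extension J (AtLeast k R C)"
    then obtain T where T: "T \<subseteq> f ` ({y. (x, y) \<in> role I R \<and> y \<in> extension I C} \<inter> S)"
        "finite T" "card T = numeral k"
      using succ[OF x] by auto
    then obtain U where U: "U \<subseteq> {y. (x, y) \<in> role I R \<and> y \<in> extension I C} \<inter> S" "T = f ` U"
      by (auto simp: subset_image_iff)
    have "inj_on f U" using U inj by (meson inj_on_subset le_infE)
    then have "finite U" "card U = numeral k"
      using T U by (auto simp: finite_image_iff card_image)
    then show "x \<in> extension I (AtLeast k R C)" using U x S by auto
  next
    assume "x \<in> extension I (AtLeast k R C)"
    then obtain T where T: "T \<subseteq> S" "T \<subseteq> {y. (x, y) \<in> role I R \<and> y \<in> extension I C}"
        "finite T" "card T = numeral k"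
      using closed[OF x, of k R C] by blast
    have "card (f ` T) = numeral k" using T inj by (metis card_image inj_on_subset)
    moreover have "f ` T \<subseteq> {z. (f x, z) \<in> role J R \<and> z \<in> extension J C}"
      unfolding succ[OF x] using T by blast
    moreover have "f x \<in> domain J" using x by (simp add: J_def)
    ultimately show "f x \<in> extension J (AtLeast k R C)"
      unfolding extension.simps mem_Collect_eq using finite_imageI[OF T(3), of f] by blast
  qed
  moreover have "extension J (AtLeast k R C) \<subseteq> f ` S" by (auto simp: J_def)
  ultimately show ?case by blast
qed

lemma extension_subset_domain: "is_interp I \<Longrightarrow> extension I C \<subseteq> domain I"
  by (induction C) (auto simp: is_interp_def)

lemma subsumed_extension:
  fixes I :: "'d interp"
  assumes sub: "subsumed C D" and I: "is_interp I"
  shows "extension I C \<subseteq> extension I D"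
proof
  fix x assume xC: "x \<in> extension I C"
  define W where "W = (\<lambda>y (k, R, E). if y \<in> extension I (AtLeast k R E) then
      (SOME T. T \<subseteq> {z. (y, z) \<in> role I R \<and> z \<in> extension I E} \<and> finite T \<and> card T = numeral k) else {})"
  have W: "W y (k, R, E) \<subseteq> {z. (y, z) \<in> role I R \<and> z \<in> extension I E} \<and> finite (W y (k, R, E)) \<and>
      card (W y (k, R, E)) = numeral k" if "y \<in> extension I (AtLeast k R E)" for y k R E
  proof -
    have "\<exists>T. T \<subseteq> {z. (y, z) \<in> role I R \<and> z \<in> extension I E} \<and> finite T \<and> card T = numeral k"
      using that by simp
    from someI_ex[OF this] show ?thesis using that unfolding W_def by (simp only: prod.case if_True)
  qed
  have Wfin: "finite (W y t) \<and> W y t \<subseteq> domain I" for y t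
  proof (cases t)
    case (fields k R E)
    show ?thesis
    proof (cases "y \<in> extension I (AtLeast k R E)")
      case True
      then show ?thesis using W[OF True] fields extension_subset_domain[OF I, of E] by blast
    next
      case False
      then show ?thesis using fields by (simp add: W_def del: extension.simps)
    qed
  qed
  define F where "F = (\<lambda>n. ((\<lambda>X. \<Union>y\<in>X. \<Union>t. W y t) ^^ n) {x})"
  define S where "S = (\<Union>n. F n)"
  have FS: "F (Suc n) = (\<Union>y\<in>F n. \<Union>t. W y t)" for n by (simp add: F_def)
  have "countable (F n) \<and> F n \<subseteq> domain I" for n
  proof (induction n)
    case 0
    show ?case using xC extension_subset_domain[OF I] by (auto simp: F_def)
  next
    case (Suc n)
    then have "countable (F (Suc n))"
      using Wfin unfolding FS by (intro countable_UN) (simp_all add: countable_finite)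
    moreover have "F (Suc n) \<subseteq> domain I" using Wfin unfolding FS by blast
    ultimately show ?case by blast
  qed
  then have S: "countable S" "S \<subseteq> domain I" by (auto simp: S_def)
  have xS: "x \<in> S" unfolding S_def F_def by (rule UN_I[of 0]) auto
  have SW: "W y t \<subseteq> S" if yS: "y \<in> S" for y t
  proof -
    obtain n where "y \<in> F n" using yS by (auto simp: S_def)
    then have "W y t \<subseteq> F (Suc n)" unfolding FS by blast
    then show ?thesis by (auto simp: S_def)
  qed
  define f where "f = to_nat_on S"
  have inj: "inj_on f S" unfolding f_def using S(1) by (rule inj_on_to_nat_on)
  define J where "J = \<lparr>domain = f ` S, conc = (\<lambda>A. f ` (conc I A \<inter> S)),
                role = (\<lambda>R. map_prod f f ` (role I R \<inter> S \<times> S))\<rparr>"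
  have eq: "extension J E = f ` (extension I E \<inter> S)" for E
    unfolding J_def
  proof (rule extension_transfer[OF I S(2) inj])
    fix y k R E assume "y \<in> S" "y \<in> extension I (AtLeast k R E)"
    then show "\<exists>T\<subseteq>S. T \<subseteq> {z. (y, z) \<in> role I R \<and> z \<in> extension I E} \<and> finite T \<and> card T = numeral k"
      using SW[of y "(k, R, E)"] W[of y k R E] by blast
  qed
  have "is_interp J" using xS by (auto simp: is_interp_def J_def)
  then have "extension J C \<subseteq> extension J D" using sub by (simp add: subsumed_def)
  then have "f x \<in> f ` (extension I D \<inter> S)" using xC xS unfolding eq by blast
  then show "x \<in> extension I D" using inj xS by (auto simp: inj_on_eq_iff)
qed

lemma subsumed_iff:
  assumes inf: "infinite (UNIV :: 'd set)"
  shows "subsumed C D \<longleftrightarrow> (\<forall>I :: 'd interp. is_interp I \<longrightarrow> extension I C \<subseteq> extension I D)"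
proof
  assume "subsumed C D"
  then show "\<forall>I :: 'd interp. is_interp I \<longrightarrow> extension I C \<subseteq> extension I D"
    using subsumed_extension by blast
next
  assume R: "\<forall>I :: 'd interp. is_interp I \<longrightarrow> extension I C \<subseteq> extension I D"
  obtain f :: "nat \<Rightarrow> 'd" where f: "inj f" using inf by (meson infinite_countable_subset)
  show "subsumed C D"
    unfolding subsumed_def
  proof (intro allI impI)
    fix I :: "nat interp" assume I: "is_interp I"
    define S where "S = domain I"
    define J where "J = \<lparr>domain = f ` S, conc = (\<lambda>A. f ` (conc I A \<inter> S)),
                role = (\<lambda>R. map_prod f f ` (role I R \<inter> S \<times> S))\<rparr>"
    have inj: "inj_on f S" using f by (meson inj_on_subset subset_UNIV)
    have eq: "extension J E = f ` (extension I E \<inter> S)" for E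
      unfolding J_def
    proof (rule extension_transfer[OF I _ inj])
      show "S \<subseteq> domain I" by (simp add: S_def)
      fix y k R E assume "y \<in> S" "y \<in> extension I (AtLeast k R E)"
      then obtain T where T: "T \<subseteq> {z. (y, z) \<in> role I R \<and> z \<in> extension I E}" "finite T" "card T = numeral k"
        by auto
      moreover have "T \<subseteq> S" using T(1) extension_subset_domain[OF I, of E] by (auto simp: S_def)
      ultimately show "\<exists>T\<subseteq>S. T \<subseteq> {z. (y, z) \<in> role I R \<and> z \<in> extension I E} \<and> finite T \<and> card T = numeral k"
        by blast
    qed
    have "is_interp J" using I by (auto simp: is_interp_def J_def S_def)
    then have "extension J C \<subseteq> extension J D" using R by blast
    then have "extension I C \<inter> S \<subseteq> extension I D \<inter> S"
      unfolding eq using inj_image_subset_iff[OF f] by simp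
    then show "extension I C \<subseteq> extension I D"
      using extension_subset_domain[OF I, of C] by (auto simp: S_def)
  qed
qed


section \<open>Concepts as words\<close>

text \<open>A concept is written over a finite alphabet as \<open>A\<^bsub>w\<^esub>\<close>, \<open>\<top>\<close>, \<open>(C \<sqinter> D)\<close> or \<open>(\<ge> k R\<^bsub>w\<^esub>. C)\<close>,
  with \<open>w\<close> and \<open>k\<close> in binary.\<close>

datatype letter = Dig bool | LConc | LRole | LTop | LAnd | LGeq | LDot | LOpen | LClose | LSub

text \<open>Most significant digit first.\<close>

primrec digits :: "num \<Rightarrow> bool list" where
  "digits num.One = [True]"
| "digits (num.Bit0 k) = digits k @ [False]"
| "digits (num.Bit1 k) = digits k @ [True]"

primrec word_of :: "concept \<Rightarrow> letter list" where
  "word_of (Atom A) = LConc # map Dig A"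
| "word_of Top = [LTop]"
| "word_of (And C D) = [LOpen] @ word_of C @ [LAnd] @ word_of D @ [LClose]"
| "word_of (AtLeast k R C) =
     [LOpen, LGeq] @ map Dig (digits k) @ [LRole] @ map Dig R @ [LDot] @ word_of C @ [LClose]"

definition csize :: "concept \<Rightarrow> nat" where
  "csize C = length (word_of C)"

definition input_word :: "concept \<Rightarrow> concept \<Rightarrow> letter list" where
  "input_word C D = word_of C @ [LSub] @ word_of D"


section \<open>Deterministic multi-tape Turing machines\<close>

datatype 'a cell = Blank | Input 'a | Work nat

datatype move = MLeft | MStay | MRight

record 'a tm =
  tapes :: nat
  states :: "nat set"
  alphabet :: "'a cell set"
  start :: nat
  accept :: nat
  reject :: nat
  delta :: "nat \<Rightarrow> 'a cell list \<Rightarrow> nat \<times> ('a cell \<times> move) list"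

definition turing_machine :: "'a tm \<Rightarrow> bool" where
  "turing_machine M \<longleftrightarrow>
     tapes M \<ge> 1 \<and> finite (states M) \<and> finite (alphabet M) \<and>
     {start M, accept M, reject M} \<subseteq> states M \<and> accept M \<noteq> reject M \<and>
     Blank \<in> alphabet M \<and> range Input \<subseteq> alphabet M \<and>
     (\<forall>q\<in>states M. \<forall>cs. length cs = tapes M \<and> set cs \<subseteq> alphabet M \<longrightarrow>
        (case delta M q cs of (q', as) \<Rightarrow>
           q' \<in> states M \<and> length as = tapes M \<and> fst ` set as \<subseteq> alphabet M))"

text \<open>Tapes are infinite in both directions; the second component is the head position.\<close>

type_synonym 'a tape = "(int \<Rightarrow> 'a cell) \<times> int"

type_synonym 'a config = "nat \<times> 'a tape list"

fun scanned :: "'a tape \<Rightarrow> 'a cell" where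
  "scanned (t, h) = t h"

fun shift :: "move \<Rightarrow> int \<Rightarrow> int" where
  "shift MLeft h = h - 1"
| "shift MStay h = h"
| "shift MRight h = h + 1"

fun act :: "'a cell \<times> move \<Rightarrow> 'a tape \<Rightarrow> 'a tape" where
  "act (c, m) (t, h) = (t(h := c), shift m h)"

fun step :: "'a tm \<Rightarrow> 'a config \<Rightarrow> 'a config" where
  "step M (q, ts) =
     (if q = accept M \<or> q = reject M then (q, ts)
      else case delta M q (map scanned ts) of (q', as) \<Rightarrow> (q', map2 act as ts))"

definition input_tape :: "'a list \<Rightarrow> 'a tape" where
  "input_tape w = ((\<lambda>i. if 0 \<le> i \<and> i < int (length w) then Input (w ! nat i) else Blank), 0)"

definition initial :: "'a tm \<Rightarrow> 'a list \<Rightarrow> 'a config" where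
  "initial M w = (start M, input_tape w # replicate (tapes M - 1) (input_tape []))"

definition accepts_within :: "'a tm \<Rightarrow> 'a list \<Rightarrow> nat \<Rightarrow> bool" where
  "accepts_within M w n \<longleftrightarrow> (\<exists>t\<le>n. fst ((step M ^^ t) (initial M w)) = accept M)"

definition rejects_within :: "'a tm \<Rightarrow> 'a list \<Rightarrow> nat \<Rightarrow> bool" where
  "rejects_within M w n \<longleftrightarrow> (\<exists>t\<le>n. fst ((step M ^^ t) (initial M w)) = reject M)"

end

theory Submission imports Defs begin

text \<open>\<open>C \<sqsubseteq> D\<close> holds iff every conjunct of \<open>D\<close> is matched by a single conjunct of \<open>C\<close>: a name by the
  same name, and \<open>\<ge> k R. D'\<close> by some \<open>\<ge> l R. C'\<close> with \<open>k \<le> l\<close> and \<open>C' \<sqsubseteq> D'\<close>.  Restrictions of \<open>C\<close> do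
  not add up, because successors required by different conjuncts may be shared; one universal
  interpretation, whose elements each refute a single conjunct and are otherwise as permissive as
  possible, contains all counterexamples.

  A machine with one head on each concept evaluates this recursion without a stack: the word of a
  concept determines the parent and the siblings of each occurrence, and a unary counter suffices to
  match parentheses.  Evaluation changes no tape, so a configuration consists of a state and three
  head positions, and there are only cubically many.  A halting run never repeats a configuration.\<close>


section \<open>Structural characterisation of subsumption\<close>

fun struct_subsumed :: "concept \<Rightarrow> concept \<Rightarrow> bool" where
  "struct_subsumed C Top \<longleftrightarrow> True"
| "struct_subsumed C (And D E) \<longleftrightarrow> struct_subsumed C D \<and> struct_subsumed C E"
| "struct_subsumed (And B C) D \<longleftrightarrow> struct_subsumed B D \<or> struct_subsumed C D"
| "struct_subsumed (Atom A) (Atom B) \<longleftrightarrow> A = B"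
| "struct_subsumed (AtLeast l S C) (AtLeast k R D) \<longleftrightarrow>
    k \<le> l \<and> S = R \<and> struct_subsumed C D"
| "struct_subsumed _ _ \<longleftrightarrow> False"

primrec basic :: "concept \<Rightarrow> bool" where
  "basic (Atom A) \<longleftrightarrow> True"
| "basic Top \<longleftrightarrow> False"
| "basic (And C D) \<longleftrightarrow> False"
| "basic (AtLeast k R C) \<longleftrightarrow> True"

lemma struct_subsumed_And_basic:
  "basic D \<Longrightarrow> struct_subsumed (And B C) D \<longleftrightarrow> struct_subsumed B D \<or> struct_subsumed C D"
  by (cases D) auto

lemma not_struct_subsumed_Top_basic: "basic D \<Longrightarrow> \<not> struct_subsumed Top D"
  by (cases D) auto

lemma extension_AtLeast_mono:
  assumes "k \<le> l" "extension I C \<subseteq> extension I D"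
  shows "extension I (AtLeast l R C) \<subseteq> extension I (AtLeast k R D)"
proof
  fix x assume "x \<in> extension I (AtLeast l R C)"
  then obtain S where "x \<in> domain I" "card S = numeral l"
      and successors: "S \<subseteq> {y. (x, y) \<in> role I R \<and> y \<in> extension I C}"
    by auto
  then have "numeral k \<le> card S" using assms(1) by simp
  then obtain T where "T \<subseteq> S" "card T = numeral k" "finite T"
    using obtain_subset_with_card_n by metis
  then show "x \<in> extension I (AtLeast k R D)"
    using \<open>x \<in> domain I\<close> successors assms(2) by auto
qed

lemma struct_subsumed_sound:
  assumes "is_interp I"
  shows "struct_subsumed C D \<Longrightarrow> extension I C \<subseteq> extension I D"
proof (induction C D
    rule: struct_subsumed.induct[case_names Top And_Rhs And_Atom And_AtLeast Atom AtLeast])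
  case (Top C)
  show ?case using extension_subset_domain[OF assms] by simp
next
  case (AtLeast l S C k R D)
  then show ?case by (simp only: struct_subsumed.simps extension_AtLeast_mono)
qed auto

primrec conjuncts :: "concept \<Rightarrow> concept set" where
  "conjuncts (Atom A) = {Atom A}"
| "conjuncts Top = {}"
| "conjuncts (And C D) = conjuncts C \<union> conjuncts D"
| "conjuncts (AtLeast k R C) = {AtLeast k R C}"

lemma conjuncts_basic: "D \<in> conjuncts C \<Longrightarrow> basic D"
  by (induction C) auto

lemma struct_subsumed_conjuncts: "struct_subsumed C D \<longleftrightarrow> (\<forall>E\<in>conjuncts D. struct_subsumed C E)"
  by (induction D) auto

text \<open>For basic \<open>D\<close> the elements \<open>(D, n)\<close> are the most permissive ones outside the extension of
  \<open>D\<close>; the elements \<open>(Top, n)\<close> lie in every extension.  The index \<open>n\<close> only provides infinitely many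
  copies.\<close>

fun refuter_succ :: "concept \<Rightarrow> name \<Rightarrow> (concept \<times> nat) set" where
  "refuter_succ (AtLeast k R D) S =
     (if S = R then {Top} \<times> {..<numeral k - 1} \<union> conjuncts D \<times> UNIV else UNIV)"
| "refuter_succ _ S = UNIV"

definition refuter_interp :: "(concept \<times> nat) interp" where
  "refuter_interp = \<lparr>domain = UNIV, conc = (\<lambda>A. {(D, n). D \<noteq> Atom A}),
     role = (\<lambda>S. {((D, n), y). y \<in> refuter_succ D S})\<rparr>"

lemma refuter_interp_simps [simp]:
  "domain refuter_interp = UNIV"
  "(D, n) \<in> conc refuter_interp A \<longleftrightarrow> D \<noteq> Atom A"
  "((D, n), y) \<in> role refuter_interp S \<longleftrightarrow> y \<in> refuter_succ D S"
  by (simp_all add: refuter_interp_def)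

lemma is_interp_refuter_interp: "is_interp refuter_interp"
  by (simp add: is_interp_def refuter_interp_def)

lemma extension_AtLeast_refuterI:
  assumes "{E} \<times> {..<numeral k} \<subseteq> refuter_succ D R \<inter> extension refuter_interp C"
  shows "(D, n) \<in> extension refuter_interp (AtLeast k R C)"
proof -
  have "card ({E} \<times> {..<numeral k :: nat}) = numeral k" by simp
  then show ?thesis using assms by (auto intro!: exI[of _ "{E} \<times> {..<numeral k}"])
qed

lemma Top_in_extension_refuter: "(Top, n) \<in> extension refuter_interp C"
proof (induction C arbitrary: n)
  case (AtLeast k R C)
  then show ?case by (intro extension_AtLeast_refuterI[of Top]) auto
qed auto

lemma refuter_notin_extension: "D \<in> conjuncts C \<Longrightarrow> (D, n) \<notin> extension refuter_interp C"
proof (induction C arbitrary: D n)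
  case (AtLeast k R C)
  let ?succ = "refuter_succ (AtLeast k R C) R \<inter> extension refuter_interp C"
  have few: "card S < numeral k" if "S \<subseteq> ?succ" for S
  proof -
    have "S \<subseteq> {Top} \<times> {..<numeral k - 1}" using that AtLeast.IH by auto
    then have "card S \<le> card ({Top} \<times> {..<numeral k - 1 :: nat})" by (intro card_mono) auto
    also have "\<dots> < numeral k" by (simp add: numeral_eq_Suc)
    finally show ?thesis .
  qed
  show ?case
  proof
    assume "(D, n) \<in> extension refuter_interp (AtLeast k R C)"
    then obtain S where "S \<subseteq> ?succ" "card S = numeral k"
      using AtLeast.prems by (auto simp del: refuter_succ.simps)
    then show False using few[of S] by (simp del: refuter_succ.simps)
  qed
qed auto

lemma refuter_in_extension:
  "basic D \<Longrightarrow> \<not> struct_subsumed C D \<Longrightarrow> (D, n) \<in> extension refuter_interp C"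
proof (induction C arbitrary: D n)
  case (And B C)
  then show ?case by (simp add: struct_subsumed_And_basic)
next
  case (AtLeast l S C)
  have "\<exists>E. {E} \<times> {..<numeral l} \<subseteq> refuter_succ D S \<inter> extension refuter_interp C"
  proof (cases "\<exists>k D'. D = AtLeast k S D'")
    case False
    then have "refuter_succ D S = UNIV" by (cases D) auto
    then show ?thesis using Top_in_extension_refuter by blast
  next
    case True
    then obtain k D' where D_eq: "D = AtLeast k S D'" by blast
    show ?thesis
    proof (cases "struct_subsumed C D'")
      case True
      then have "(numeral l :: nat) < numeral k" using AtLeast.prems(2) D_eq by simp
      then have "{..<numeral l} \<subseteq> {..<numeral k - 1 :: nat}"
        unfolding lessThan_subset_iff by linarith
      then show ?thesis using D_eq Top_in_extension_refuter by (intro exI[of _ Top]) auto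
    next
      case False
      then obtain E where "E \<in> conjuncts D'" "\<not> struct_subsumed C E"
        using struct_subsumed_conjuncts by blast
      then show ?thesis using D_eq AtLeast.IH conjuncts_basic by (intro exI[of _ E]) auto
    qed
  qed
  then show ?case using extension_AtLeast_refuterI by blast
qed auto

lemma subsumed_iff_struct_subsumed: "subsumed C D \<longleftrightarrow> struct_subsumed C D"
proof
  assume "subsumed C D"
  then have inclusion: "extension refuter_interp C \<subseteq> extension refuter_interp D"
    by (rule subsumed_extension[OF _ is_interp_refuter_interp])
  show "struct_subsumed C D"
  proof (rule ccontr)
    assume "\<not> struct_subsumed C D"
    then obtain E where "E \<in> conjuncts D" "\<not> struct_subsumed C E"
      using struct_subsumed_conjuncts by blast
    then show False
      using inclusion refuter_in_extension refuter_notin_extension conjuncts_basic by blast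
  qed
next
  assume "struct_subsumed C D"
  then show "subsumed C D" unfolding subsumed_def by (intro allI impI struct_subsumed_sound)
qed


section \<open>Comparison of binary numerals\<close>

text \<open>\<open>c\<close> is the outcome of the comparison at the first position so far where the words differ.\<close>

fun digits_ge :: "bool option \<Rightarrow> bool list \<Rightarrow> bool list \<Rightarrow> bool" where
  "digits_ge c (a # u) (b # v) \<longleftrightarrow> digits_ge (if c = None \<and> a \<noteq> b then Some a else c) u v"
| "digits_ge c [] [] \<longleftrightarrow> c \<noteq> Some False"
| "digits_ge c (a # u) [] \<longleftrightarrow> True"
| "digits_ge c [] (b # v) \<longleftrightarrow> False"

lemma digits_ge_longer: "length v < length u \<Longrightarrow> digits_ge c u v"
  by (induction c u v rule: digits_ge.induct) auto

lemma digits_ge_shorter: "length u < length v \<Longrightarrow> \<not> digits_ge c u v"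
  by (induction c u v rule: digits_ge.induct) auto

lemma digits_ge_decided: "length u = length v \<Longrightarrow> digits_ge (Some b) u v \<longleftrightarrow> b"
  by (induction u v rule: list_induct2) auto

lemma digits_ge_None_iff_lexordp_eq: "length u = length v \<Longrightarrow> digits_ge None u v \<longleftrightarrow> lexordp_eq v u"
  by (induction u v rule: list_induct2) (auto simp: digits_ge_decided)

lemma horner_sum_digits: "horner_sum of_bool 2 (rev (digits k)) = (numeral k :: nat)"
  by (induction k) (simp_all add: numeral_Bit0 numeral_Bit1)

lemma two_power_length_digits_le:
  "2 ^ length (digits k) \<le> 2 * (horner_sum of_bool 2 (rev (digits k)) :: nat)"
  by (induction k) simp_all

lemma less_if_length_digits_less:
  assumes "length (digits k) < length (digits l)"
  shows "k < l"
proof -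
  let ?value = "\<lambda>k. horner_sum of_bool 2 (rev (digits k)) :: nat"
  have "2 * ?value k < 2 ^ Suc (length (digits k))"
    using horner_sum_of_bool_2_less[of "rev (digits k)"] by simp
  also have "\<dots> \<le> 2 ^ length (digits l)" using assms by (intro power_increasing) auto
  also have "\<dots> \<le> 2 * ?value l" by (rule two_power_length_digits_le)
  finally have "?value k < ?value l" by simp
  then show ?thesis by (simp add: horner_sum_digits)
qed

lemma digits_ge_digits: "digits_ge None (digits k) (digits l) \<longleftrightarrow> l \<le> k"
proof (cases "length (digits k)" "length (digits l)" rule: linorder_cases)
  case less
  then show ?thesis using less_if_length_digits_less[of k l] by (simp add: digits_ge_shorter)
next
  case equal
  then have "digits_ge None (digits k) (digits l) \<longleftrightarrow>
      horner_sum of_bool 2 (rev (digits l)) \<le> (horner_sum of_bool 2 (rev (digits k)) :: nat)"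
    by (simp add: digits_ge_None_iff_lexordp_eq horner_sum_less_eq_iff_lexordp_eq)
  then show ?thesis by (simp add: horner_sum_digits)
next
  case greater
  then show ?thesis using less_if_length_digits_less[of l k] by (simp add: digits_ge_longer)
qed


section \<open>Runs and tapes\<close>

definition reaches_in :: "'a tm \<Rightarrow> nat \<Rightarrow> 'a config \<Rightarrow> 'a config \<Rightarrow> bool" where
  "reaches_in M n a b \<longleftrightarrow> (step M ^^ n) a = b"

lemma reaches_in_0 [simp]: "reaches_in M 0 a b \<longleftrightarrow> a = b"
  by (simp add: reaches_in_def)

lemma reaches_in_Suc_0 [simp]: "reaches_in M (Suc 0) a b \<longleftrightarrow> step M a = b"
  by (simp add: reaches_in_def)

lemma reaches_in_trans [trans]: "reaches_in M m a b \<Longrightarrow> reaches_in M n b c \<Longrightarrow> reaches_in M (m + n) a c"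
  unfolding reaches_in_def by (subst add.commute) (simp add: funpow_add)

definition reaches :: "'a tm \<Rightarrow> 'a config \<Rightarrow> 'a config \<Rightarrow> bool" where
  "reaches M a b \<longleftrightarrow> (\<exists>n. reaches_in M n a b)"

lemma reaches_refl: "reaches M a a"
  unfolding reaches_def using reaches_in_0 by blast

lemma reaches_step: "step M a = b \<Longrightarrow> reaches M a b"
  unfolding reaches_def using reaches_in_Suc_0 by blast

lemma reaches_trans [trans]: "reaches M a b \<Longrightarrow> reaches M b c \<Longrightarrow> reaches M a c"
  unfolding reaches_def using reaches_in_trans by blast

lemma reaches_in_le_card:
  assumes "finite S" "\<And>c. c \<in> S \<Longrightarrow> step M c \<in> S" "a \<in> S" "reaches M a b"
  shows "\<exists>t\<le>card S. reaches_in M t a b"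
proof -
  define graph where "graph = (\<lambda>c. (c, step M c)) ` S"
  obtain n where n: "(step M ^^ n) a = b" using assms(4) by (auto simp: reaches_def reaches_in_def)
  have "(step M ^^ k) a \<in> S \<and> (a, (step M ^^ k) a) \<in> graph ^^ k" for k
    using assms(2,3) by (induction k) (auto simp: graph_def)
  then have "(a, b) \<in> graph ^^ n" using n by blast
  moreover have "finite graph" "card graph = card S"
    using assms(1) by (simp_all add: graph_def card_image inj_on_def)
  ultimately obtain t where "t \<le> card S" "(a, b) \<in> graph ^^ t"
    using relpow_finite_bounded[of graph n] by auto
  moreover have "(a, c) \<in> graph ^^ k \<Longrightarrow> (step M ^^ k) a = c" for k c
    by (induction k arbitrary: c) (auto simp: graph_def)
  ultimately show ?thesis unfolding reaches_in_def by blast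
qed

definition reads :: "(int \<Rightarrow> 'a cell) \<Rightarrow> int \<Rightarrow> 'a list \<Rightarrow> bool" where
  "reads T i u \<longleftrightarrow> (\<forall>k<length u. T (i + int k) = Input (u ! k))"

lemma reads_Nil [simp]: "reads T i []"
  by (simp add: reads_def)

lemma reads_Cons [simp]: "reads T i (a # u) \<longleftrightarrow> T i = Input a \<and> reads T (i + 1) u"
  by (auto simp: reads_def less_Suc_eq_0_disj algebra_simps)

lemma reads_append [simp]: "reads T i (u @ v) \<longleftrightarrow> reads T i u \<and> reads T (i + int (length u)) v"
  by (induction u arbitrary: i) (auto simp: algebra_simps)

definition cells :: "'a list \<Rightarrow> int \<Rightarrow> 'a cell" where
  "cells w i = (if 0 \<le> i \<and> i < int (length w) then Input (w ! nat i) else Blank)"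

lemma input_tape_eq_cells: "input_tape w = (cells w, 0)"
  by (simp add: input_tape_def cells_def fun_eq_iff)

lemma reads_cells: "reads (cells w) 0 w"
  by (simp add: reads_def cells_def)

lemma cells_eq_Blank_iff: "cells w i = Blank \<longleftrightarrow> i \<notin> {0..<int (length w)}"
  by (auto simp: cells_def)

lemma cells_snoc: "(cells w)(int (length w) := Input a) = cells (w @ [a])"
  by (auto simp: cells_def fun_eq_iff nth_append)


section \<open>Occurrences of concepts\<close>

lemma csize_simps [simp]:
  "csize (Atom A) = Suc (length A)"
  "csize Top = 1"
  "csize (And C D) = csize C + csize D + 3"
  "csize (AtLeast k R C) = length (digits k) + length R + csize C + 5"
  by (simp_all add: csize_def)

text \<open>The letter behind the word ensures that the name of an atom ends there.\<close>

definition concept_at :: "(int \<Rightarrow> letter cell) \<Rightarrow> int \<Rightarrow> concept \<Rightarrow> bool" where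
  "concept_at T i C \<longleftrightarrow>
     reads T i (word_of C) \<and> T (i + int (csize C)) \<in> Input ` {LAnd, LClose, LSub}"

lemma concept_at_hd: "concept_at T i C \<Longrightarrow> T i \<in> Input ` {LConc, LTop, LOpen}"
  by (cases C) (auto simp: concept_at_def)

lemma concept_at_And:
  assumes "concept_at T i (And C D)"
  shows "T i = Input LOpen" "concept_at T (i + 1) C" "T (i + 1 + int (csize C)) = Input LAnd"
    "concept_at T (i + 1 + int (csize C) + 1) D"
  using assms by (auto simp: concept_at_def csize_def add_ac)

lemma concept_at_AtLeast:
  fixes i :: int
  assumes "concept_at T i (AtLeast k R C)"
  defines "name \<equiv> i + 3 + int (length (digits k))"
  defines "dot \<equiv> name + int (length R)"
  shows "T i = Input LOpen" "T (i + 1) = Input LGeq"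
    "reads T (i + 2) (map Dig (digits k) @ [LRole])"
    "reads T name (map Dig R)" "T dot = Input LDot" "concept_at T (dot + 1) C"
  using assms(1) by (auto simp: concept_at_def name_def dot_def csize_def add_ac)

text \<open>The flag permits \<open>LAnd\<close> outside of parentheses, where the search for a right conjunct stops.\<close>

inductive balanced :: "bool \<Rightarrow> letter list \<Rightarrow> bool" where
  Nil: "balanced d []"
| Cons: "a \<notin> {LOpen, LClose} \<Longrightarrow> (a = LAnd \<Longrightarrow> d) \<Longrightarrow> balanced d u \<Longrightarrow> balanced d (a # u)"
| paren: "balanced True u \<Longrightarrow> balanced d v \<Longrightarrow> balanced d (LOpen # u @ LClose # v)"

lemma balanced_append: "balanced d u \<Longrightarrow> balanced d v \<Longrightarrow> balanced d (u @ v)"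
  by (induction rule: balanced.induct) (auto intro: balanced.intros)

lemma balanced_map_Dig: "balanced d (map Dig u)"
  by (induction u) (auto intro: balanced.intros)

lemma balanced_word_of: "balanced d (word_of C)"
proof (induction C arbitrary: d)
  case (And C D)
  have "balanced True (word_of C @ LAnd # word_of D)"
    using And by (intro balanced_append balanced.Cons) auto
  then show ?case using balanced.paren[OF _ balanced.Nil] by fastforce
next
  case (AtLeast k R C)
  have "balanced True (LGeq # map Dig (digits k) @ LRole # map Dig R @ LDot # word_of C)"
    using AtLeast by (intro balanced_append balanced.Cons balanced_map_Dig) auto
  then show ?case using balanced.paren[OF _ balanced.Nil] by fastforce
qed (auto intro: balanced.intros balanced_map_Dig)

text \<open>The header of an atom is the atom, the header of a restriction is the part before its body.\<close>

definition header_at :: "(int \<Rightarrow> letter cell) \<Rightarrow> int \<Rightarrow> int \<Rightarrow> bool" where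
  "header_at T i j \<longleftrightarrow> i \<le> j \<and> T i \<in> Input ` {LOpen, LConc} \<and>
     (\<forall>k\<in>{i<..j}. T k \<notin> {Blank, Input LOpen, Input LConc})"

lemma header_at_mono: "header_at T i k \<Longrightarrow> i \<le> j \<Longrightarrow> j \<le> k \<Longrightarrow> header_at T i j"
  by (auto simp: header_at_def)

lemma header_at_reads:
  assumes "T i \<in> Input ` {LOpen, LConc}" "reads T (i + 1) u" "set u \<inter> {LOpen, LConc} = {}"
  shows "header_at T i (i + int (length u))"
  unfolding header_at_def
proof (intro conjI ballI)
  fix k assume k_mem: "k \<in> {i<..i + int (length u)}"
  define m where "m = nat (k - i - 1)"
  have "k = i + 1 + int m" "m < length u" using k_mem by (auto simp: m_def)
  then have "T k = Input (u ! m)" "u ! m \<in> set u" using assms(2) by (auto simp: reads_def)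
  then show "T k \<notin> {Blank, Input LOpen, Input LConc}" using assms(3) by auto
qed (use assms(1) in auto)

lemma header_at_Atom:
  assumes "concept_at T i (Atom A)"
  shows "header_at T i (i + int (csize (Atom A)))"
proof -
  obtain a where "T (i + int (csize (Atom A))) = Input a" "a \<in> {LAnd, LClose, LSub}"
    using assms by (auto simp: concept_at_def)
  then show ?thesis
    using header_at_reads[of T i "map Dig A @ [a]"] assms by (auto simp: concept_at_def add_ac)
qed

lemma header_at_AtLeast:
  assumes "concept_at T i (AtLeast k R C)"
  shows "header_at T i (i + 3 + int (length (digits k)) + int (length R))"
  using header_at_reads[of T i "LGeq # map Dig (digits k) @ LRole # map Dig R @ [LDot]"] assms
  by (auto simp: concept_at_def add_ac)


section \<open>The Turing machine\<close>

datatype side = Lhs | Rhs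

datatype control =
    Start | Copy side | Rewind side
  | Visit side | Peek side | Match | CmpNum "bool option" | CmpName | Back side bool
  | Return side bool | ReturnLeft side bool | Sibling side | Parent side bool
  | Accept | Reject

instance side :: countable by countable_datatype
instance control :: countable by countable_datatype

instance side :: finite
proof
  have "s \<in> {Lhs, Rhs}" for s by (cases s) simp_all
  then show "finite (UNIV :: side set)" by (intro finite_subset[of UNIV "{Lhs, Rhs}"]) auto
qed

instance control :: finite
proof
  let ?S = "{Start, Match, CmpName, Accept, Reject} \<union> range Copy \<union> range Rewind \<union> range Visit \<union>
    range Peek \<union> range CmpNum \<union> range (case_prod Back) \<union> range (case_prod Return) \<union>
    range (case_prod ReturnLeft) \<union> range Sibling \<union> range (case_prod Parent)"
  have "q \<in> ?S" for q by (cases q) (simp_all add: image_iff)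
  then show "finite (UNIV :: control set)" by (intro finite_subset[of UNIV ?S]) auto
qed

instance letter :: finite
proof
  let ?S = "range Dig \<union> {LConc, LRole, LTop, LAnd, LGeq, LDot, LOpen, LClose, LSub}"
  have "a \<in> ?S" for a by (cases a) simp_all
  then show "finite (UNIV :: letter set)" by (intro finite_subset[of UNIV ?S]) auto
qed

lemma all_side: "(\<forall>s. P s) \<longleftrightarrow> P Lhs \<and> P Rhs"
  by (metis side.exhaust)

definition is_digit :: "letter cell \<Rightarrow> bool" where
  "is_digit c \<longleftrightarrow> (\<exists>b. c = Input (Dig b))"

definition only :: "side \<Rightarrow> move \<Rightarrow> side \<Rightarrow> move" where
  "only s m = (\<lambda>_. MStay)(s := m)"

text \<open>Besides the input tape, with scanned cell \<open>z\<close>, there is a tape for each side \<open>s\<close> of the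
  subsumption, with scanned cell \<open>x s\<close>, on which its concept is copied between two \<open>LSub\<close>.  After
  copying, the input tape serves as a unary counter: its head moves to the left to count up, and it
  scans the mark \<open>Work 0\<close>, written behind the input, iff the counter is zero.

  A concept occurrence is addressed by its first letter.  The letter to its left shows whether it is
  a left conjunct (\<open>LOpen\<close>), a right conjunct (\<open>LAnd\<close>), the body of a restriction (\<open>LDot\<close>) or the
  whole concept (\<open>LSub\<close>).  All conjuncts on the right, but only one on the left need to match, so
  that \<open>s = Rhs\<close> is the neutral and \<open>s = Lhs\<close> the absorbing truth value on side \<open>s\<close>.  The state
  \<open>CmpNum None\<close> skips the two \<open>LGeq\<close> like any two equal digits.\<close>

primrec transition ::
  "control \<Rightarrow> (side \<Rightarrow> letter cell) \<Rightarrow> letter cell \<Rightarrow> control \<times> (side \<Rightarrow> move) \<times> move" where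
  "transition Start x z = (Copy Lhs, \<lambda>_. MRight, MStay)"
| "transition (Copy s) x z =
     (if z = Input LSub then (Copy Rhs, only s MLeft, MRight)
      else if z = Blank then (Rewind Lhs, only s MLeft, MStay)
      else (Copy s, only s MRight, MRight))"
| "transition (Rewind s) x z =
     (if x s = Input LSub then (if s = Lhs then Rewind Rhs else Visit Rhs, only s MRight, MStay)
      else (Rewind s, only s MLeft, MStay))"
| "transition (Visit s) x z =
     (if x s = Input LTop then (Return s (s = Rhs), \<lambda>_. MStay, MStay)
      else if x s = Input LOpen then (Peek s, only s MRight, MStay)
      else (if s = Lhs then Match else Visit Lhs, \<lambda>_. MStay, MStay))"
| "transition (Peek s) x z =
     (if x s = Input LGeq then (if s = Lhs then Match else Visit Lhs, only s MLeft, MStay)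
      else (Visit s, \<lambda>_. MStay, MStay))"
| "transition Match x z =
     (if x Lhs \<noteq> x Rhs then (Return Lhs False, \<lambda>_. MStay, MStay)
      else (if x Lhs = Input LConc then CmpName else CmpNum None, \<lambda>_. MRight, MStay))"
| "transition (CmpNum c) x z =
     (if x Lhs = Input LRole then
        if x Rhs = Input LRole \<and> c \<noteq> Some False then (CmpName, \<lambda>_. MRight, MStay)
        else (Back Lhs False, \<lambda>_. MStay, MStay)
      else if x Rhs = Input LRole then (CmpNum (Some True), only Lhs MRight, MStay)
      else (CmpNum (if c = None \<and> x Lhs \<noteq> x Rhs then Some (x Lhs = Input (Dig True)) else c),
        \<lambda>_. MRight, MStay))"
| "transition CmpName x z =
     (if is_digit (x Lhs) \<and> x Lhs = x Rhs then (CmpName, \<lambda>_. MRight, MStay)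
      else if is_digit (x Lhs) \<or> is_digit (x Rhs) then (Back Lhs False, \<lambda>_. MStay, MStay)
      else if x Lhs = Input LDot then (Visit Rhs, \<lambda>_. MRight, MStay)
      else (Back Lhs True, \<lambda>_. MStay, MStay))"
| "transition (Back s b) x z =
     (if x s \<in> {Input LOpen, Input LConc}
      then (if s = Lhs then Back Rhs b else Return Lhs b, \<lambda>_. MStay, MStay)
      else (Back s b, only s MLeft, MStay))"
| "transition (Return s b) x z = (ReturnLeft s b, only s MLeft, MStay)"
| "transition (ReturnLeft s b) x z =
     (if x s = Input LOpen then
        if b = (s = Lhs) then (Return s b, \<lambda>_. MStay, MStay) else (Sibling s, only s MRight, MStay)
      else if x s = Input LAnd then (Parent s b, only s MLeft, MStay)
      else if s = Lhs then (Return Rhs b, only s MRight, MStay)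
      else if x s = Input LDot then (Back Lhs b, only Lhs MLeft, MStay)
      else (if b then Accept else Reject, \<lambda>_. MStay, MStay))"
| "transition (Sibling s) x z =
     (if x s = Input LAnd \<and> z = Work 0 then (Visit s, only s MRight, MStay)
      else (Sibling s, only s MRight,
        if x s = Input LOpen then MLeft else if x s = Input LClose then MRight else MStay))"
| "transition (Parent s b) x z =
     (if x s = Input LOpen \<and> z = Work 0 then (Return s b, \<lambda>_. MStay, MStay)
      else (Parent s b, only s MLeft,
        if x s = Input LClose then MLeft else if x s = Input LOpen then MRight else MStay))"
| "transition Accept x z = (Accept, \<lambda>_. MStay, MStay)"
| "transition Reject x z = (Reject, \<lambda>_. MStay, MStay)"

fun written ::
  "control \<Rightarrow> (side \<Rightarrow> letter cell) \<Rightarrow> letter cell \<Rightarrow> (side \<Rightarrow> letter cell) \<times> letter cell" where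
  "written Start x z = (\<lambda>_. Input LSub, z)"
| "written (Copy s) x z = (if z = Blank then (x(s := Input LSub), Work 0) else (x(s := z), z))"
| "written _ x z = (x, z)"

text \<open>No head leaves a blank cell.  This confines the heads to finitely many cells after copying.\<close>

definition guard :: "'a cell \<Rightarrow> move \<Rightarrow> 'a cell \<times> move" where
  "guard c m = (c, if c = Blank then MStay else m)"

definition subsumption_tm :: "letter tm" where
  "subsumption_tm = \<lparr>tapes = 3, states = range (to_nat :: control \<Rightarrow> nat),
     alphabet = {Blank, Work 0} \<union> range Input,
     start = to_nat Start, accept = to_nat Accept, reject = to_nat Reject,
     delta = (\<lambda>q cs.
       let z = cs ! 0; x = case_side (cs ! 1) (cs ! 2);
         (q', m, n) = transition (from_nat q) x z; (x', z') = written (from_nat q) x z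
       in (to_nat q', [guard z' n, guard (x' Lhs) (m Lhs), guard (x' Rhs) (m Rhs)]))\<rparr>"

lemma turing_machine_subsumption_tm: "turing_machine subsumption_tm"
proof -
  have written: "z' \<in> \<Gamma> \<and> x' s \<in> \<Gamma>"
    if "written q x z = (x', z')" "z \<in> \<Gamma>" "\<And>s. x s \<in> \<Gamma>" "{Work 0, Input LSub} \<subseteq> \<Gamma>"
    for q x z x' z' s \<Gamma>
    using that by (cases "(q, x, z)" rule: written.cases) (auto split: if_splits)
  have delta: "case delta subsumption_tm q cs of (q', as) \<Rightarrow>
      q' \<in> states subsumption_tm \<and> length as = tapes subsumption_tm \<and>
      fst ` set as \<subseteq> alphabet subsumption_tm"
    if "length cs = tapes subsumption_tm" and "set cs \<subseteq> alphabet subsumption_tm" for q cs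
  proof -
    have "length cs = Suc (Suc (Suc 0))" using that(1) by (simp add: subsumption_tm_def)
    then obtain z y1 y2 where cs: "cs = [z, y1, y2]" by (auto simp: length_Suc_conv)
    obtain x' z' where written_eq: "written (from_nat q) (case_side y1 y2) z = (x', z')"
      by fastforce
    have "z' \<in> alphabet subsumption_tm \<and> x' s \<in> alphabet subsumption_tm" for s
      using that(2)
      by (intro written[OF written_eq]) (auto simp: cs subsumption_tm_def split: side.split)
    then show ?thesis by (auto simp: cs subsumption_tm_def written_eq guard_def split: prod.split)
  qed
  show ?thesis
    unfolding turing_machine_def
    by (intro conjI ballI allI impI delta) (auto simp: subsumption_tm_def)
qed

definition config :: "control \<Rightarrow> (int \<Rightarrow> letter cell) \<Rightarrow> int \<Rightarrow> (side \<Rightarrow> int \<Rightarrow> letter cell) \<Rightarrow>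
    (side \<Rightarrow> int) \<Rightarrow> letter config" where
  "config q Z h T p = (to_nat q, [(Z, h), (T Lhs, p Lhs), (T Rhs, p Rhs)])"

definition glide :: "'a cell \<Rightarrow> move \<Rightarrow> int \<Rightarrow> int" where
  "glide c m h = (if c = Blank then h else shift m h)"

lemma glide_simps [simp]:
  "glide Blank m h = h"
  "glide (Input a) m h = shift m h"
  "glide (Work k) m h = shift m h"
  "glide c MStay h = h"
  by (simp_all add: glide_def)

lemma glide_neq_Blank: "c \<noteq> Blank \<Longrightarrow> glide c m h = shift m h"
  by (simp add: glide_def)

lemma step_config:
  assumes "q \<notin> {Accept, Reject}"
  shows "step subsumption_tm (config q Z h T p) =
    (case transition q (\<lambda>s. T s (p s)) (Z h) of (q', m, n) \<Rightarrow>
     case written q (\<lambda>s. T s (p s)) (Z h) of (x, z) \<Rightarrow>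
       config q' (Z(h := z)) (glide z n h) (\<lambda>s. (T s)(p s := x s)) (\<lambda>s. glide (x s) (m s) (p s)))"
proof -
  have "case_side (T Lhs (p Lhs)) (T Rhs (p Rhs)) = (\<lambda>s. T s (p s))"
    by (simp add: fun_eq_iff all_side)
  then show ?thesis
    using assms by (simp add: config_def subsumption_tm_def guard_def glide_def split: prod.split)
qed

lemma glide_only [simp]: "(\<lambda>s. glide (x s) (only t m s) (p s)) = p(t := glide (x t) m (p t))"
  by (auto simp: only_def fun_eq_iff)


section \<open>Copying the concepts\<close>

lemma LSub_notin_word_of: "LSub \<notin> set (word_of C)"
  by (induction C) auto

lemma append_cells:
  assumes "T s = cells v" "p s = int (length v)"
  shows "(\<lambda>t. (T t)(p t := if t = s then Input a else T t (p t))) = T(s := cells (v @ [a]))"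
  using assms by (auto simp: fun_eq_iff cells_snoc[symmetric])

lemma step_Copy:
  assumes "T s = cells v" "p s = int (length v)" "Z h = Input a" "a \<noteq> LSub"
  shows "step subsumption_tm (config (Copy s) Z h T p) =
    config (Copy s) Z (h + 1) (T(s := cells (v @ [a]))) (p(s := int (length (v @ [a]))))"
  using assms by (simp add: step_config append_cells fun_upd_idem add.commute)

lemma step_Copy_LSub:
  assumes "T s = cells v" "p s = int (length v)" "Z h = Input LSub"
  shows "step subsumption_tm (config (Copy s) Z h T p) =
    config (Copy Rhs) Z (h + 1) (T(s := cells (v @ [LSub]))) (p(s := int (length v) - 1))"
  using assms by (simp add: step_config append_cells fun_upd_idem)

lemma step_Copy_Blank:
  assumes "T s = cells v" "p s = int (length v)" "Z h = Blank"
  shows "step subsumption_tm (config (Copy s) Z h T p) =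
    config (Rewind Lhs) (Z(h := Work 0)) h (T(s := cells (v @ [LSub])))
      (p(s := int (length v) - 1))"
  using assms by (simp add: step_config append_cells)

lemma reaches_in_Copy:
  assumes "LSub \<notin> set u" "reads Z h u" "T s = cells v" "p s = int (length v)"
  shows "reaches_in subsumption_tm (length u) (config (Copy s) Z h T p)
    (config (Copy s) Z (h + int (length u)) (T(s := cells (v @ u))) (p(s := int (length (v @ u)))))"
  using assms
proof (induction u arbitrary: h T p v)
  case Nil
  then show ?case by (simp add: fun_upd_idem)
next
  case (Cons a u)
  let ?T = "T(s := cells (v @ [a]))" and ?p = "p(s := int (length (v @ [a])))"
  have "reaches_in subsumption_tm 1 (config (Copy s) Z h T p) (config (Copy s) Z (h + 1) ?T ?p)"
    using Cons.prems step_Copy[of T s v p Z h a] by auto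
  also have "reaches_in subsumption_tm (length u) \<dots> (config (Copy s) Z (h + 1 + int (length u))
      (?T(s := cells ((v @ [a]) @ u))) (?p(s := int (length ((v @ [a]) @ u)))))"
    using Cons.prems by (intro Cons.IH) auto
  finally show ?case by (simp add: add_ac del: fun_upd_apply)
qed

lemma reaches_in_Rewind:
  assumes "LSub \<notin> set u" "T s = cells (LSub # u @ v)" "p s = int n" "n \<le> length u"
  shows "reaches_in subsumption_tm (n + 1) (config (Rewind s) Z h T p)
    (config (if s = Lhs then Rewind Rhs else Visit Rhs) Z h T (p(s := 1)))"
  using assms(3,4)
proof (induction n arbitrary: p)
  case 0
  then have "T s (p s) = Input LSub" using assms(2) by (simp add: cells_def)
  then show ?case using 0 by (simp add: step_config del: fun_upd_apply)
next
  case (Suc n)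
  have "T s (p s) \<in> Input ` set u"
    using assms(2) Suc.prems by (simp add: cells_def nth_append)
  then have "T s (p s) \<noteq> Blank" "T s (p s) \<noteq> Input LSub" using assms(1) by auto
  then have "reaches_in subsumption_tm 1 (config (Rewind s) Z h T p)
      (config (Rewind s) Z h T (p(s := int n)))"
    using Suc.prems by (simp add: step_config glide_neq_Blank)
  also have "reaches_in subsumption_tm (n + 1) \<dots>
    (config (if s = Lhs then Rewind Rhs else Visit Rhs) Z h T (p(s := 1)))"
    using Suc.IH[of "p(s := int n)"] Suc.prems by (simp add: fun_upd_same del: fun_upd_apply)
  finally show ?case by (simp del: fun_upd_apply)
qed

definition counter_tape :: "concept \<Rightarrow> concept \<Rightarrow> int \<Rightarrow> letter cell" where
  "counter_tape C D = (cells (input_word C D))(int (csize C + csize D + 1) := Work 0)"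

definition concept_tapes :: "concept \<Rightarrow> concept \<Rightarrow> side \<Rightarrow> int \<Rightarrow> letter cell" where
  "concept_tapes C D s = cells (LSub # word_of (if s = Lhs then C else D) @ [LSub])"

lemma reaches_in_rewinding:
  "reaches_in subsumption_tm (csize C + csize D + 2)
    (config (Rewind Lhs) Z h (concept_tapes C D) (case_side (int (csize C)) (int (csize D))))
    (config (Visit Rhs) Z h (concept_tapes C D) (\<lambda>_. 1))"
proof -
  let ?T = "concept_tapes C D" and ?p = "case_side 1 (int (csize D))"
  have "(case_side (int (csize C)) (int (csize D)))(Lhs := 1) = ?p"
    by (simp add: fun_eq_iff all_side)
  then have "reaches_in subsumption_tm (csize C + 1)
      (config (Rewind Lhs) Z h ?T (case_side (int (csize C)) (int (csize D))))
      (config (Rewind Rhs) Z h ?T ?p)"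
    using reaches_in_Rewind[OF LSub_notin_word_of[of C], of ?T Lhs "[LSub]"
        "case_side (int (csize C)) (int (csize D))" "csize C"]
    by (simp add: concept_tapes_def csize_def)
  also have "?p(Rhs := 1) = (\<lambda>_. 1)" by (simp add: fun_eq_iff all_side)
  then have "reaches_in subsumption_tm (csize D + 1) (config (Rewind Rhs) Z h ?T ?p)
      (config (Visit Rhs) Z h ?T (\<lambda>_. 1))"
    using reaches_in_Rewind[OF LSub_notin_word_of[of D], of ?T Rhs "[LSub]" ?p "csize D"]
    by (simp add: concept_tapes_def csize_def)
  finally show ?thesis by simp
qed

lemma reaches_in_copying:
  "reaches_in subsumption_tm (2 * (csize C + csize D) + 5) (initial subsumption_tm (input_word C D))
    (config (Visit Rhs) (counter_tape C D) (int (csize C + csize D + 1)) (concept_tapes C D)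
      (\<lambda>_. 1))"
proof -
  let ?Z = "cells (input_word C D)" and ?Z' = "counter_tape C D"
  let ?T = "\<lambda>_. cells [LSub]" and ?T' = "concept_tapes C D"
  let ?c = "int (csize C)" and ?d = "int (csize D)" and ?n = "int (csize C + csize D + 1)"
  let ?p = "\<lambda>_. 1 :: int"
  have input: "reads ?Z 0 (word_of C)" "?Z ?c = Input LSub" "reads ?Z (?c + 1) (word_of D)"
    using reads_cells[of "input_word C D"] by (simp_all add: input_word_def csize_def)
  have input_end: "?Z ?n = Blank" by (simp add: cells_def input_word_def csize_def)
  have time: "2 * (csize C + csize D) + 5 =
      1 + csize C + 1 + csize D + 1 + (csize C + csize D + 2)" by simp
  have "initial subsumption_tm (input_word C D) = config Start ?Z 0 (\<lambda>_. cells []) (\<lambda>_. 0)"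
    by (simp add: initial_def config_def subsumption_tm_def input_tape_eq_cells numeral_2_eq_2)
  also have "reaches_in subsumption_tm 1 \<dots> (config (Copy Lhs) ?Z 0 ?T ?p)"
    using cells_snoc[of "[]" LSub] by (simp add: step_config)
  also have "reaches_in subsumption_tm (csize C) \<dots>
      (config (Copy Lhs) ?Z ?c (?T(Lhs := cells (LSub # word_of C))) (?p(Lhs := ?c + 1)))"
    using reaches_in_Copy[OF LSub_notin_word_of input(1), of ?T Lhs "[LSub]" ?p]
    by (simp add: csize_def add.commute)
  also have "reaches_in subsumption_tm 1 \<dots>
      (config (Copy Rhs) ?Z (?c + 1) (?T(Lhs := ?T' Lhs)) (?p(Lhs := ?c)))"
    using input(2)
    by (simp add: step_Copy_LSub[where v = "LSub # word_of C"] concept_tapes_def csize_def)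
  also have "reaches_in subsumption_tm (csize D) \<dots> (config (Copy Rhs) ?Z ?n
      (?T(Lhs := ?T' Lhs, Rhs := cells (LSub # word_of D))) (?p(Lhs := ?c, Rhs := ?d + 1)))"
    using reaches_in_Copy[OF LSub_notin_word_of input(3), of "?T(Lhs := ?T' Lhs)" Rhs "[LSub]"
        "?p(Lhs := ?c)"]
    by (simp add: csize_def add_ac)
  also have "reaches_in subsumption_tm 1 \<dots> (config (Rewind Lhs) ?Z' ?n
      (?T(Lhs := ?T' Lhs, Rhs := ?T' Rhs)) (?p(Lhs := ?c, Rhs := ?d)))"
    using input_end by (simp add: step_Copy_Blank[where v = "LSub # word_of D"] concept_tapes_def
        counter_tape_def csize_def)
  also have "?T(Lhs := ?T' Lhs, Rhs := ?T' Rhs) = ?T'" by (simp add: fun_eq_iff all_side)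
  also have "?p(Lhs := ?c, Rhs := ?d) = case_side ?c ?d" by (simp add: fun_eq_iff all_side)
  also note reaches_in_rewinding
  finally show ?thesis unfolding time .
qed


section \<open>Deciding structural subsumption\<close>

abbreviation leads_to :: "letter config \<Rightarrow> letter config \<Rightarrow> bool"  (infix "\<leadsto>" 50) where
  "a \<leadsto> b \<equiv> reaches subsumption_tm a b"

locale prepared_tapes =
  fixes counter :: "int \<Rightarrow> letter cell" and tape :: "side \<Rightarrow> int \<Rightarrow> letter cell" and n :: nat
  assumes counter_mark: "counter (int n) = Work 0"
    and counter_letter: "0 \<le> h \<Longrightarrow> h < int n \<Longrightarrow> counter h \<in> range Input"
    and counter_outside: "h \<notin> {0..int n} \<Longrightarrow> counter h = Blank"
    and tape_outside: "i \<notin> {0..int n} \<Longrightarrow> tape s i = Blank"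
begin

definition conf :: "control \<Rightarrow> (side \<Rightarrow> int) \<Rightarrow> int \<Rightarrow> letter config" where
  "conf q p h = config q counter h tape p"

abbreviation idle :: "control \<Rightarrow> (side \<Rightarrow> int) \<Rightarrow> letter config" where
  "idle q p \<equiv> conf q p (int n)"

definition advance :: "(side \<Rightarrow> move) \<Rightarrow> (side \<Rightarrow> int) \<Rightarrow> side \<Rightarrow> int" where
  "advance m p = (\<lambda>s. glide (tape s (p s)) (m s) (p s))"

lemma advance_stay [simp]: "advance (\<lambda>_. MStay) p = p"
  by (simp add: advance_def)

lemma advance_only [simp]: "advance (only s m) p = p(s := glide (tape s (p s)) m (p s))"
  by (simp add: advance_def)

lemma advance_all: "(\<And>s. tape s (p s) \<noteq> Blank) \<Longrightarrow> advance (\<lambda>_. m) p = (\<lambda>s. shift m (p s))"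
  by (simp add: advance_def glide_neq_Blank)

lemma step_conf:
  assumes "q \<notin> {Start, Accept, Reject}" "\<And>s. q \<noteq> Copy s"
  shows "step subsumption_tm (conf q p h) =
    (case transition q (\<lambda>s. tape s (p s)) (counter h) of (q', m, k) \<Rightarrow>
      conf q' (advance m p) (glide (counter h) k h))"
proof -
  have "written q x z = (x, z)" for x z using assms by (cases q) auto
  then show ?thesis
    using assms by (simp add: conf_def advance_def step_config split: prod.split)
qed

lemma counter_neq_Blank: "0 \<le> h \<Longrightarrow> h \<le> int n \<Longrightarrow> counter h \<noteq> Blank"
  using counter_mark counter_letter[of h] by (cases "h = int n") auto

lemma counter_neq_mark: "0 \<le> h \<Longrightarrow> h < int n \<Longrightarrow> counter h \<noteq> Work 0"
  using counter_letter[of h] by auto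

lemma reads_length_le:
  assumes "reads (tape s) i u"
  shows "length u \<le> n + 1"
proof (cases u)
  case (Cons a v)
  then have "tape s i \<noteq> Blank" using assms by simp
  moreover have "tape s (i + int (length v)) \<noteq> Blank" using assms Cons by (simp add: reads_def)
  ultimately have "0 \<le> i \<and> i + int (length v) \<le> int n" by (metis atLeastAtMost_iff tape_outside)
  then show ?thesis using Cons by simp
qed simp


subsection \<open>Conjunctions\<close>

lemma reaches_Sibling:
  assumes "balanced d u" "reads (tape s) i u" "d \<Longrightarrow> h < int n" "int (length u) \<le> h" "h \<le> int n"
  shows "conf (Sibling s) (p(s := i)) h \<leadsto> conf (Sibling s) (p(s := i + int (length u))) h"
  using assms
proof (induction arbitrary: i h rule: balanced.induct)
  case (Nil d)
  show ?case by (simp add: reaches_refl)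
next
  case (Cons a d u)
  have "conf (Sibling s) (p(s := i)) h \<leadsto> conf (Sibling s) (p(s := i + 1)) h"
    using Cons.hyps Cons.prems counter_neq_mark[of h] by (intro reaches_step) (auto simp: step_conf)
  also have "\<dots> \<leadsto> conf (Sibling s) (p(s := i + 1 + int (length u))) h"
    using Cons.prems by (intro Cons.IH) auto
  finally show ?case by (simp add: add_ac del: fun_upd_apply)
next
  case (paren u d v)
  define j where "j = i + 1 + int (length u)"
  have tape: "tape s i = Input LOpen" "reads (tape s) (i + 1) u"
      "tape s j = Input LClose" "reads (tape s) (j + 1) v"
    using paren.prems(1) by (simp_all add: j_def add_ac)
  have counter: "counter h \<noteq> Blank" "counter (h - 1) \<noteq> Blank"
    using paren.prems counter_neq_Blank[of h] counter_neq_Blank[of "h - 1"] by simp_all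
  have "conf (Sibling s) (p(s := i)) h \<leadsto> conf (Sibling s) (p(s := i + 1)) (h - 1)"
    using tape counter by (intro reaches_step) (simp add: step_conf glide_neq_Blank)
  also have "\<dots> \<leadsto> conf (Sibling s) (p(s := j)) (h - 1)"
    unfolding j_def using tape(2) paren.prems by (intro paren.IH(1)) auto
  also have "\<dots> \<leadsto> conf (Sibling s) (p(s := j + 1)) h"
    using tape counter by (intro reaches_step) (simp add: step_conf glide_neq_Blank)
  also have "\<dots> \<leadsto> conf (Sibling s) (p(s := j + 1 + int (length v))) h"
    using tape(4) paren.prems by (intro paren.IH(2)) auto
  finally show ?case by (simp add: j_def add_ac del: fun_upd_apply)
qed

lemma reaches_Parent:
  assumes "balanced d u" "reads (tape s) (i + 1) u" "int (length u) \<le> h" "h \<le> int n"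
  shows "conf (Parent s b) (p(s := i + int (length u))) h \<leadsto> conf (Parent s b) (p(s := i)) h"
  using assms
proof (induction arbitrary: i h rule: balanced.induct)
  case (Nil d)
  show ?case by (simp add: reaches_refl)
next
  case (Cons a d u)
  have "conf (Parent s b) (p(s := i + 1 + int (length u))) h \<leadsto> conf (Parent s b) (p(s := i + 1)) h"
    using Cons.prems by (intro Cons.IH) auto
  also have "\<dots> \<leadsto> conf (Parent s b) (p(s := i)) h"
    using Cons.hyps Cons.prems by (intro reaches_step) (auto simp: step_conf)
  finally show ?case by (simp add: add_ac del: fun_upd_apply)
next
  case (paren u d v)
  define j where "j = i + 1 + int (length u)"
  have tape: "tape s (i + 1) = Input LOpen" "reads (tape s) (i + 1 + 1) u"
      "tape s (j + 1) = Input LClose" "reads (tape s) (j + 1 + 1) v"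
    using paren.prems(1) by (simp_all add: j_def add_ac)
  have counter: "counter h \<noteq> Blank" "counter (h - 1) \<noteq> Blank" "counter (h - 1) \<noteq> Work 0"
    using paren.prems counter_neq_Blank[of h] counter_neq_Blank[of "h - 1"]
      counter_neq_mark[of "h - 1"] by simp_all
  have "conf (Parent s b) (p(s := j + 1 + int (length v))) h \<leadsto> conf (Parent s b) (p(s := j + 1)) h"
    using tape(4) paren.prems by (intro paren.IH(2)) auto
  also have "\<dots> \<leadsto> conf (Parent s b) (p(s := j)) (h - 1)"
    using tape counter by (intro reaches_step) (simp add: step_conf glide_neq_Blank)
  also have "\<dots> \<leadsto> conf (Parent s b) (p(s := i + 1)) (h - 1)"
    unfolding j_def using tape(2) paren.prems by (intro paren.IH(1)) auto
  also have "\<dots> \<leadsto> conf (Parent s b) (p(s := i)) h"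
    using tape counter by (intro reaches_step) (simp add: step_conf glide_neq_Blank)
  finally show ?case by (simp add: j_def add_ac del: fun_upd_apply)
qed

lemma Visit_left_conjunct:
  assumes "concept_at (tape s) i (And C D)"
    and visit: "idle (Visit s) (p(s := i + 1)) \<leadsto> idle (Return s b) (p(s := i + 1))"
  shows "idle (Visit s) (p(s := i)) \<leadsto> idle (ReturnLeft s b) (p(s := i))"
proof -
  note tape = concept_at_And(1)[OF assms(1)] concept_at_hd[OF concept_at_And(2)[OF assms(1)]]
  have "idle (Visit s) (p(s := i)) \<leadsto> idle (Peek s) (p(s := i + 1))"
    using tape by (intro reaches_step) (simp add: step_conf)
  also have "\<dots> \<leadsto> idle (Visit s) (p(s := i + 1))"
    using tape by (intro reaches_step) (auto simp: step_conf)
  also note visit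
  also have "idle (Return s b) (p(s := i + 1)) \<leadsto> idle (ReturnLeft s b) (p(s := i))"
    using tape by (intro reaches_step) (auto simp: step_conf)
  finally show ?thesis .
qed

lemma Visit_right_conjunct:
  assumes "concept_at (tape s) i (And C D)" "b \<noteq> (s = Lhs)" "j = i + 1 + int (csize C)"
    and visit: "idle (Visit s) (p(s := j + 1)) \<leadsto> idle (Return s b') (p(s := j + 1))"
  shows "idle (ReturnLeft s b) (p(s := i)) \<leadsto> idle (Return s b') (p(s := i))"
proof -
  have tape: "tape s i = Input LOpen" "tape s j = Input LAnd" "reads (tape s) (i + 1) (word_of C)"
      "tape s (j + 1) \<noteq> Blank"
    using concept_at_And[OF assms(1)] concept_at_hd[OF concept_at_And(4)[OF assms(1)]] assms(3)
    by (auto simp: concept_at_def)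
  have size: "length (word_of C) \<le> n"
    using reads_length_le[of s i "word_of (And C D)"] assms(1) by (simp add: concept_at_def)
  have "idle (ReturnLeft s b) (p(s := i)) \<leadsto> idle (Sibling s) (p(s := i + 1))"
    using tape(1) assms(2) by (intro reaches_step) (simp add: step_conf)
  also have "\<dots> \<leadsto> idle (Sibling s) (p(s := j))"
    unfolding assms(3) csize_def using balanced_word_of[of False] tape(3) size
    by (intro reaches_Sibling[where d = False]) simp_all
  also have "\<dots> \<leadsto> idle (Visit s) (p(s := j + 1))"
    using tape(2) counter_mark by (intro reaches_step) (simp add: step_conf)
  also note visit
  also have "idle (Return s b') (p(s := j + 1)) \<leadsto> idle (ReturnLeft s b') (p(s := j))"
    using tape(4) by (intro reaches_step) (simp add: step_conf glide_neq_Blank)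
  also have "\<dots> \<leadsto> idle (Parent s b') (p(s := i + int (csize C)))"
    using tape(2) by (intro reaches_step) (simp add: step_conf assms(3))
  also have "\<dots> \<leadsto> idle (Parent s b') (p(s := i))"
    unfolding csize_def using balanced_word_of tape(3) size by (intro reaches_Parent) simp_all
  also have "\<dots> \<leadsto> idle (Return s b') (p(s := i))"
    using tape(1) counter_mark by (intro reaches_step) (simp add: step_conf)
  finally show ?thesis .
qed

lemma Visit_And:
  assumes "concept_at (tape s) i (And C D)"
    and visit: "\<And>E j. E \<in> {C, D} \<Longrightarrow> concept_at (tape s) j E \<Longrightarrow>
      idle (Visit s) (p(s := j)) \<leadsto> idle (Return s (v E)) (p(s := j))"
  shows "idle (Visit s) (p(s := i)) \<leadsto>
    idle (Return s (if v C = (s = Lhs) then v C else v D)) (p(s := i))"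
proof -
  note tape = concept_at_And[OF assms(1)]
  have "idle (Visit s) (p(s := i)) \<leadsto> idle (ReturnLeft s (v C)) (p(s := i))"
    using tape(2) by (intro Visit_left_conjunct[OF assms(1)] visit) simp_all
  also have "\<dots> \<leadsto> idle (Return s (if v C = (s = Lhs) then v C else v D)) (p(s := i))"
  proof (cases "v C = (s = Lhs)")
    case True
    then show ?thesis using tape(1) by (intro reaches_step) (simp add: step_conf)
  next
    case False
    have "idle (ReturnLeft s (v C)) (p(s := i)) \<leadsto> idle (Return s (v D)) (p(s := i))"
      by (intro Visit_right_conjunct[OF assms(1) False refl] visit tape(4)) simp
    then show ?thesis using False by simp
  qed
  finally show ?thesis .
qed

lemma Visit_Top:
  assumes "tape s (p s) = Input LTop"
  shows "idle (Visit s) p \<leadsto> idle (Return s (s = Rhs)) p"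
  using assms by (intro reaches_step) (simp add: step_conf)


subsection \<open>Basic concepts\<close>

lemma Visit_basic:
  assumes "basic C" "concept_at (tape s) (p s) C"
  shows "idle (Visit s) p \<leadsto> idle (if s = Lhs then Match else Visit Lhs) p"
proof (cases C)
  case (Atom A)
  then show ?thesis using assms by (intro reaches_step) (simp add: step_conf concept_at_def)
next
  case (AtLeast k R E)
  then have tape: "tape s (p s) = Input LOpen" "tape s (p s + 1) = Input LGeq"
    using assms by (simp_all add: concept_at_def)
  have "idle (Visit s) p \<leadsto> idle (Peek s) (p(s := p s + 1))"
    using tape by (intro reaches_step) (simp add: step_conf)
  also have "\<dots> \<leadsto> idle (if s = Lhs then Match else Visit Lhs) p"
    using tape by (intro reaches_step) (simp add: step_conf fun_upd_idem)
  finally show ?thesis .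
qed (use assms in auto)

lemma Back_to_header:
  assumes "header_at (tape s) i j"
  shows "idle (Back s b) (p(s := j)) \<leadsto> idle (Back s b) (p(s := i))"
proof -
  have "i \<le> j" using assms by (simp add: header_at_def)
  then show ?thesis using assms
  proof (induction j rule: int_ge_induct)
    case base
    show ?case by (rule reaches_refl)
  next
    case (step j)
    then have "tape s (j + 1) \<notin> {Blank, Input LOpen, Input LConc}" by (simp add: header_at_def)
    then have "idle (Back s b) (p(s := j + 1)) \<leadsto> idle (Back s b) (p(s := j))"
      by (intro reaches_step) (simp add: step_conf glide_neq_Blank)
    also have "\<dots> \<leadsto> idle (Back s b) (p(s := i))"
      using step.hyps step.prems by (intro step.IH header_at_mono[OF step.prems]) simp_all
    finally show ?case .
  qed
qed

lemma Back_Lhs: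
  assumes header: "\<And>s. header_at (tape s) (r s) (p s)"
  shows "idle (Back Lhs b) p \<leadsto> idle (Return Lhs b) r"
proof -
  let ?p = "p(Lhs := r Lhs)"
  have returned: "?p(Rhs := r Rhs) = r" by (simp add: fun_eq_iff all_side)
  have start: "tape s (r s) = Input LOpen \<or> tape s (r s) = Input LConc" for s
    using header[of s] by (auto simp: header_at_def)
  have "idle (Back Lhs b) p \<leadsto> idle (Back Lhs b) ?p"
    using Back_to_header[OF header[of Lhs], of b p] by simp
  also have "\<dots> \<leadsto> idle (Back Rhs b) ?p"
    using start[of Lhs] by (intro reaches_step) (auto simp: step_conf)
  also have "\<dots> \<leadsto> idle (Back Rhs b) r"
    using Back_to_header[OF header[of Rhs], of b ?p] by (simp add: returned fun_upd_idem)
  also have "\<dots> \<leadsto> idle (Return Lhs b) r"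
    using start[of Rhs] by (intro reaches_step) (auto simp: step_conf)
  finally show ?thesis .
qed

lemma CmpName_match:
  assumes "\<And>s. tape s (p s) = Input (Dig a)"
  shows "idle CmpName p \<leadsto> idle CmpName (\<lambda>s. p s + 1)"
  using assms by (intro reaches_step) (simp add: step_conf is_digit_def advance_all)

lemma CmpName_mismatch:
  assumes names: "\<And>s. reads (tape s) (p s) (map Dig (A s))"
      "\<And>s. \<not> is_digit (tape s (p s + int (length (A s))))"
    and header: "\<And>s. header_at (tape s) (r s) (p s)"
    and mismatch: "A Lhs \<noteq> [] \<or> A Rhs \<noteq> []"
      "A Lhs = [] \<or> A Rhs = [] \<or> hd (A Lhs) \<noteq> hd (A Rhs)"
  shows "idle CmpName p \<leadsto> idle (Return Lhs False) r"
proof -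
  have first: "if A s = [] then \<not> is_digit (tape s (p s))
      else tape s (p s) = Input (Dig (hd (A s)))" for s
    using names[of s] by (cases "A s") auto
  have "is_digit (tape Lhs (p Lhs)) \<or> is_digit (tape Rhs (p Rhs))"
    using mismatch(1) first[of Lhs] first[of Rhs] by (auto simp: is_digit_def)
  moreover have "tape Lhs (p Lhs) \<noteq> tape Rhs (p Rhs)"
    using mismatch first[of Lhs] first[of Rhs] by (fastforce simp: is_digit_def split: if_splits)
  ultimately have "idle CmpName p \<leadsto> idle (Back Lhs False) p"
    by (intro reaches_step) (auto simp: step_conf)
  also have "\<dots> \<leadsto> idle (Return Lhs False) r" using header by (rule Back_Lhs)
  finally show ?thesis .
qed

lemma reaches_CmpName:
  assumes "\<And>s. reads (tape s) (p s) (map Dig (A s))"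
    and "\<And>s. \<not> is_digit (tape s (p s + int (length (A s))))"
    and "\<And>s. r s \<le> p s" "\<And>s. header_at (tape s) (r s) (p s + int (length (A s)))"
  shows "idle CmpName p \<leadsto>
    (if A Lhs = A Rhs then idle CmpName (\<lambda>s. p s + int (length (A s)))
     else idle (Return Lhs False) r)"
  using assms
proof (induction "length (A Lhs)" arbitrary: A p rule: less_induct)
  case less
  consider (empty) "A Lhs = []" "A Rhs = []"
    | (match) "A Lhs \<noteq> []" "A Rhs \<noteq> []" "hd (A Lhs) = hd (A Rhs)"
    | (mismatch) "A Lhs \<noteq> [] \<or> A Rhs \<noteq> []"
        "A Lhs = [] \<or> A Rhs = [] \<or> hd (A Lhs) \<noteq> hd (A Rhs)"
    by blast
  then show ?case
  proof cases
    case empty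
    then have "A = (\<lambda>_. [])" by (simp add: fun_eq_iff all_side)
    then show ?thesis by (simp add: reaches_refl)
  next
    case match
    define a where "a = hd (A Lhs)"
    define B where "B = (\<lambda>s. tl (A s))"
    have "A s \<noteq> [] \<and> hd (A s) = a" for s using match by (cases s) (simp_all add: a_def)
    then have A_eq: "A s = a # B s" for s using list.collapse[of "A s"] by (simp add: B_def)
    have "idle CmpName p \<leadsto> idle CmpName (\<lambda>s. p s + 1)"
      using less.prems(1) by (intro CmpName_match[of p a]) (simp add: A_eq)
    also have "\<dots> \<leadsto> (if B Lhs = B Rhs then idle CmpName (\<lambda>s. p s + 1 + int (length (B s)))
        else idle (Return Lhs False) r)"
      using less.prems by (intro less.hyps) (simp_all add: A_eq add_increasing2 add.assoc)
    finally show ?thesis by (simp add: A_eq add.assoc cong: if_cong)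
  next
    case mismatch
    have "header_at (tape s) (r s) (p s)" for s
      by (rule header_at_mono[OF less.prems(4,3)]) simp
    from CmpName_mismatch[OF less.prems(1,2) this mismatch] show ?thesis using mismatch by auto
  qed
qed

lemma CmpNum_digits:
  assumes "\<And>s. tape s (p s) = Input (Dig (d s))"
  shows "idle (CmpNum c) p \<leadsto>
    idle (CmpNum (if c = None \<and> d Lhs \<noteq> d Rhs then Some (d Lhs) else c)) (\<lambda>s. p s + 1)"
  using assms by (intro reaches_step) (simp add: step_conf advance_all)

lemma CmpNum_greater_eq:
  assumes "tape Rhs (p Rhs) = Input LRole" "reads (tape Lhs) i (map Dig u @ [LRole])"
    and "u = [] \<Longrightarrow> c \<noteq> Some False"
  shows "idle (CmpNum c) (p(Lhs := i)) \<leadsto>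
    idle CmpName (p(Lhs := i + int (length u) + 1, Rhs := p Rhs + 1))"
  using assms(2,3)
proof (induction u arbitrary: i c)
  case Nil
  have "tape s ((p(Lhs := i)) s) = Input LRole" for s
    using Nil.prems(1) assms(1) by (cases s) simp_all
  then have "idle (CmpNum c) (p(Lhs := i)) \<leadsto> idle CmpName (\<lambda>s. (p(Lhs := i)) s + 1)"
    using Nil.prems(2) by (intro reaches_step) (simp add: step_conf advance_all del: fun_upd_apply)
  also have "(\<lambda>s. (p(Lhs := i)) s + 1) = p(Lhs := i + int (length []) + 1, Rhs := p Rhs + 1)"
    by (simp add: fun_eq_iff all_side)
  finally show ?case .
next
  case (Cons a u)
  have "idle (CmpNum c) (p(Lhs := i)) \<leadsto> idle (CmpNum (Some True)) (p(Lhs := i + 1))"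
    using Cons.prems(1) assms(1) by (intro reaches_step) (simp add: step_conf)
  also have "\<dots> \<leadsto> idle CmpName (p(Lhs := i + 1 + int (length u) + 1, Rhs := p Rhs + 1))"
    using Cons.prems(1) by (intro Cons.IH) simp_all
  finally show ?case by (simp add: add_ac del: fun_upd_apply)
qed

lemma CmpNum_less:
  assumes "tape Lhs (p Lhs) = Input LRole" "tape Rhs (p Rhs) \<noteq> Input LRole \<or> c = Some False"
    and "\<And>s. header_at (tape s) (r s) (p s)"
  shows "idle (CmpNum c) p \<leadsto> idle (Return Lhs False) r"
proof -
  have "idle (CmpNum c) p \<leadsto> idle (Back Lhs False) p"
    using assms(1,2) by (intro reaches_step) (auto simp: step_conf)
  also have "\<dots> \<leadsto> idle (Return Lhs False) r" using assms(3) by (rule Back_Lhs)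
  finally show ?thesis .
qed

lemma CmpNum_Rhs_exhausted:
  assumes numbers: "\<And>s. reads (tape s) (p s) (map Dig (u s) @ [LRole])" "u Rhs = []"
    and "\<And>s. r s \<le> p s" "\<And>s. header_at (tape s) (r s) (p s + int (length (u s)))"
  shows "idle (CmpNum c) p \<leadsto>
    (if digits_ge c (u Lhs) [] then idle CmpName (\<lambda>s. p s + int (length (u s)) + 1)
     else idle (Return Lhs False) r)"
proof (cases "digits_ge c (u Lhs) []")
  case True
  have "(\<lambda>s. p s + int (length (u s)) + 1) =
      p(Lhs := p Lhs + int (length (u Lhs)) + 1, Rhs := p Rhs + 1)"
    by (simp add: fun_eq_iff all_side numbers(2))
  moreover have "u Lhs = [] \<Longrightarrow> c \<noteq> Some False" using True by auto
  ultimately show ?thesis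
    using CmpNum_greater_eq[of p "p Lhs" "u Lhs" c] numbers(1)[of Lhs] numbers(1)[of Rhs] True
    by (simp add: numbers(2))
next
  case False
  then have "u Lhs = []" "c = Some False" by (cases "u Lhs"; simp)+
  moreover have "header_at (tape s) (r s) (p s)" for s
    by (rule header_at_mono[OF assms(4,3)]) simp
  ultimately show ?thesis using numbers(1)[of Lhs] by (simp add: CmpNum_less)
qed

lemma reaches_CmpNum:
  assumes "\<And>s. reads (tape s) (p s) (map Dig (u s) @ [LRole])"
    and "\<And>s. r s \<le> p s" "\<And>s. header_at (tape s) (r s) (p s + int (length (u s)))"
  shows "idle (CmpNum c) p \<leadsto>
    (if digits_ge c (u Lhs) (u Rhs) then idle CmpName (\<lambda>s. p s + int (length (u s)) + 1)
     else idle (Return Lhs False) r)"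
  using assms
proof (induction c "u Lhs" "u Rhs" arbitrary: u p
    rule: digits_ge.induct[case_names both none longer shorter])
  case (both c a v b w)
  define x where "x = case_side v w"
  have u_eq: "u s = case_side a b s # x s" for s
    using both.hyps(2,3) by (cases s) (simp_all add: x_def)
  let ?c = "if c = None \<and> a \<noteq> b then Some a else c" and ?p = "\<lambda>s. p s + 1"
  have "idle (CmpNum c) p \<leadsto> idle (CmpNum ?c) ?p"
    using both.prems(1) CmpNum_digits[of p "case_side a b" c, unfolded side.case]
    by (simp add: u_eq)
  also have "\<dots> \<leadsto> (if digits_ge ?c (x Lhs) (x Rhs)
      then idle CmpName (\<lambda>s. ?p s + int (length (x s)) + 1) else idle (Return Lhs False) r)"
  proof (rule both.hyps(1))
    show "reads (tape s) (?p s) (map Dig (x s) @ [LRole])" "r s \<le> ?p s"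
      "header_at (tape s) (r s) (?p s + int (length (x s)))" for s
      using both.prems[of s] by (simp_all add: u_eq add_increasing2 add.assoc)
  qed (simp_all add: x_def)
  finally show ?case by (simp add: u_eq add.assoc cong: if_cong)
next
  case (none c)
  then show ?case using CmpNum_Rhs_exhausted[of p u r c] by simp
next
  case (longer c a v)
  then show ?case using CmpNum_Rhs_exhausted[of p u r c] by simp
next
  case (shorter c b w)
  then have "tape Lhs (p Lhs) = Input LRole" "tape Rhs (p Rhs) \<noteq> Input LRole"
    using shorter.prems(1)[of Lhs] shorter.prems(1)[of Rhs] by (simp_all flip: shorter.hyps)
  moreover have "header_at (tape s) (r s) (p s)" for s
    by (rule header_at_mono[OF shorter.prems(3,2)]) simp
  ultimately show ?case by (simp add: CmpNum_less flip: shorter.hyps)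
qed

lemma Match_Atom:
  assumes "\<And>s. concept_at (tape s) (p s) (Atom (A s))"
  shows "idle Match p \<leadsto> idle (Return Lhs (A Lhs = A Rhs)) p"
proof -
  let ?p = "\<lambda>s. p s + 1" and ?q = "\<lambda>s. p s + 1 + int (length (A s))"
  have tape: "tape s (p s) = Input LConc" "reads (tape s) (?p s) (map Dig (A s))"
      "tape s (?q s) \<in> Input ` {LAnd, LClose, LSub}" for s
    using assms[of s] by (simp_all add: concept_at_def add_ac)
  have boundary: "\<not> is_digit (tape s (?q s))" "tape s (?q s) \<noteq> Input LDot" for s
    using tape(3)[of s] by (auto simp: is_digit_def)
  have header: "header_at (tape s) (p s) (?q s)" for s
    using header_at_Atom[OF assms[of s]] by (simp add: add_ac)
  have "idle Match p \<leadsto> idle CmpName ?p"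
    using tape(1) by (intro reaches_step) (simp add: step_conf advance_all)
  also have "\<dots> \<leadsto> (if A Lhs = A Rhs then idle CmpName ?q else idle (Return Lhs False) p)"
    using tape(2) boundary(1) header by (intro reaches_CmpName) simp_all
  also have "\<dots> \<leadsto> idle (Return Lhs (A Lhs = A Rhs)) p"
  proof (cases "A Lhs = A Rhs")
    case True
    have "idle CmpName ?q \<leadsto> idle (Back Lhs True) ?q"
      using boundary by (intro reaches_step) (simp add: step_conf)
    also have "\<dots> \<leadsto> idle (Return Lhs True) p" using header by (rule Back_Lhs)
    finally show ?thesis using True by simp
  qed (simp add: reaches_refl)
  finally show ?thesis .
qed

lemma Return_from_body:
  assumes "\<And>s. tape s (dot s) = Input LDot" "\<And>s. concept_at (tape s) (dot s + 1) (E s)"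
    and "\<And>s. header_at (tape s) (r s) (dot s)"
  shows "idle (Return Rhs b) (\<lambda>s. dot s + 1) \<leadsto> idle (Return Lhs b) r"
proof -
  let ?p = "(\<lambda>s. dot s + 1)(Rhs := dot Rhs)"
  have "idle (Return Rhs b) (\<lambda>s. dot s + 1) \<leadsto> idle (ReturnLeft Rhs b) ?p"
    using concept_at_hd[OF assms(2)[of Rhs]] by (intro reaches_step) (auto simp: step_conf)
  also have "\<dots> \<leadsto> idle (Back Lhs b) (?p(Lhs := dot Lhs))"
    using concept_at_hd[OF assms(2)[of Lhs]] assms(1) by (intro reaches_step) (auto simp: step_conf)
  also have "?p(Lhs := dot Lhs) = dot" by (simp add: fun_eq_iff all_side)
  also have "idle (Back Lhs b) dot \<leadsto> idle (Return Lhs b) r" using assms(3) by (rule Back_Lhs)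
  finally show ?thesis .
qed

lemma Match_header:
  fixes p :: "side \<Rightarrow> int"
  assumes restriction: "\<And>s. concept_at (tape s) (p s) (AtLeast (k s) (R s) (E s))"
  defines "dot \<equiv> \<lambda>s. p s + 3 + int (length (digits (k s))) + int (length (R s))"
  shows "idle Match p \<leadsto> (if k Rhs \<le> k Lhs \<and> R Lhs = R Rhs then idle CmpName dot
    else idle (Return Lhs False) p)"
proof -
  note tape = concept_at_AtLeast[OF restriction]
  note header = header_at_AtLeast[OF restriction]
  let ?name = "\<lambda>s. p s + 3 + int (length (digits (k s)))"
  have names: "idle CmpName ?name \<leadsto>
      (if R Lhs = R Rhs then idle CmpName dot else idle (Return Lhs False) p)"
    unfolding dot_def using tape header by (intro reaches_CmpName) (simp_all add: is_digit_def)
  have "idle Match p \<leadsto> idle (CmpNum None) (\<lambda>s. p s + 1)"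
    using tape by (intro reaches_step) (simp add: step_conf advance_all)
  also have "\<dots> \<leadsto> idle (CmpNum None) (\<lambda>s. p s + 2)"
    using tape by (intro reaches_step) (simp add: step_conf advance_all add.commute)
  also have "\<dots> \<leadsto> (if digits_ge None (digits (k Lhs)) (digits (k Rhs))
      then idle CmpName (\<lambda>s. p s + 2 + int (length (digits (k s))) + 1)
      else idle (Return Lhs False) p)"
    using tape by (intro reaches_CmpNum header_at_mono[OF header]) simp_all
  also have "\<dots> = (if k Rhs \<le> k Lhs then idle CmpName ?name else idle (Return Lhs False) p)"
    by (simp add: digits_ge_digits add_ac)
  also have "\<dots> \<leadsto> (if k Rhs \<le> k Lhs \<and> R Lhs = R Rhs then idle CmpName dot
      else idle (Return Lhs False) p)"
    using names by (auto simp: reaches_refl)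
  finally show ?thesis .
qed

lemma Match_AtLeast:
  assumes restriction: "\<And>s. concept_at (tape s) (p s) (AtLeast (k s) (R s) (E s))"
    and body: "\<And>q. (\<And>s. concept_at (tape s) (q s) (E s)) \<Longrightarrow>
      (\<And>s. tape s (q s - 1) = Input LDot) \<Longrightarrow>
      idle (Visit Rhs) q \<leadsto> idle (Return Rhs b) q"
  shows "idle Match p \<leadsto> idle (Return Lhs (k Rhs \<le> k Lhs \<and> R Lhs = R Rhs \<and> b)) p"
proof -
  let ?dot = "\<lambda>s. p s + 3 + int (length (digits (k s))) + int (length (R s))"
  note tape = concept_at_AtLeast(5,6)[OF restriction]
  note Match_header[OF restriction]
  also have "(if k Rhs \<le> k Lhs \<and> R Lhs = R Rhs then idle CmpName ?dot
      else idle (Return Lhs False) p) \<leadsto> idle (Return Lhs (k Rhs \<le> k Lhs \<and> R Lhs = R Rhs \<and> b)) p"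
  proof (cases "k Rhs \<le> k Lhs \<and> R Lhs = R Rhs")
    case True
    have "idle CmpName ?dot \<leadsto> idle (Visit Rhs) (\<lambda>s. ?dot s + 1)"
      using tape(1) by (intro reaches_step) (simp add: step_conf advance_all is_digit_def)
    also have "\<dots> \<leadsto> idle (Return Rhs b) (\<lambda>s. ?dot s + 1)"
      using tape by (intro body) (simp_all add: add_ac)
    also have "\<dots> \<leadsto> idle (Return Lhs b) p"
      using tape header_at_AtLeast[OF restriction] by (rule Return_from_body)
    finally show ?thesis using True by simp
  qed (auto simp: reaches_refl)
  finally show ?thesis .
qed

lemma Match_basic:
  assumes "basic C" "basic D" "concept_at (tape Lhs) (p Lhs) C" "concept_at (tape Rhs) (p Rhs) D"
    and body: "\<And>k l R S C' D' q. C = AtLeast l S C' \<Longrightarrow> D = AtLeast k R D' \<Longrightarrow>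
      concept_at (tape Lhs) (q Lhs) C' \<Longrightarrow> concept_at (tape Rhs) (q Rhs) D' \<Longrightarrow>
      tape Lhs (q Lhs - 1) = Input LDot \<Longrightarrow>
      idle (Visit Rhs) q \<leadsto> idle (Return Rhs (struct_subsumed C' D')) q"
  shows "idle Match p \<leadsto> idle (Return Lhs (struct_subsumed C D)) p"
proof -
  consider (Atom) A B where "C = Atom A" "D = Atom B"
    | (AtLeast) l S C' k R D' where "C = AtLeast l S C'" "D = AtLeast k R D'"
    | (mixed) "\<not> struct_subsumed C D" "tape Lhs (p Lhs) \<noteq> tape Rhs (p Rhs)"
    using assms(1-4) by (cases C; cases D) (auto simp: concept_at_def)
  then show ?thesis
  proof cases
    case Atom
    then have "concept_at (tape s) (p s) (Atom (case_side A B s))" for s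
      using assms(3,4) by (cases s) simp_all
    from Match_Atom[OF this] show ?thesis using Atom by simp
  next
    case AtLeast
    then have "concept_at (tape s) (p s)
        (AtLeast (case_side l k s) (case_side S R s) (case_side C' D' s))" for s
      using assms(3,4) by (cases s) simp_all
    then have "idle Match p \<leadsto> idle (Return Lhs (case_side l k Rhs \<le> case_side l k Lhs \<and>
        case_side S R Lhs = case_side S R Rhs \<and> struct_subsumed C' D')) p"
    proof (rule Match_AtLeast)
      fix q assume "\<And>s. concept_at (tape s) (q s) (case_side C' D' s)"
        "\<And>s. tape s (q s - 1) = Input LDot"
      from this(1)[of Lhs] this(1)[of Rhs] this(2)
      show "idle (Visit Rhs) q \<leadsto> idle (Return Rhs (struct_subsumed C' D')) q"
        using AtLeast by (intro body) simp_all
    qed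
    then show ?thesis using AtLeast by simp
  next
    case mixed
    then show ?thesis by (intro reaches_step) (simp add: step_conf)
  qed
qed


subsection \<open>Whole concepts\<close>

lemma Visit_Lhs:
  assumes "basic D" "concept_at (tape Lhs) i C"
    and match: "\<And>E j. basic E \<Longrightarrow> concept_at (tape Lhs) j E \<Longrightarrow>
      idle Match (p(Lhs := j)) \<leadsto> idle (Return Lhs (struct_subsumed E D)) (p(Lhs := j))"
  shows "idle (Visit Lhs) (p(Lhs := i)) \<leadsto> idle (Return Lhs (struct_subsumed C D)) (p(Lhs := i))"
  using assms(2)
proof (induction C arbitrary: i)
  case Top
  then have "idle (Visit Lhs) (p(Lhs := i)) \<leadsto> idle (Return Lhs (Lhs = Rhs)) (p(Lhs := i))"
    by (intro Visit_Top) (simp add: concept_at_def)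
  then show ?case using not_struct_subsumed_Top_basic[OF assms(1)] by (simp del: fun_upd_apply)
next
  case (And B C)
  then have "idle (Visit Lhs) (p(Lhs := i)) \<leadsto> idle (Return Lhs (if struct_subsumed B D = (Lhs = Lhs)
      then struct_subsumed B D else struct_subsumed C D)) (p(Lhs := i))"
    by (intro Visit_And) (auto simp del: fun_upd_apply)
  then show ?case
    using struct_subsumed_And_basic[OF assms(1)] by (simp split: if_splits del: fun_upd_apply)
next
  case (Atom A)
  have "idle (Visit Lhs) (p(Lhs := i)) \<leadsto> idle Match (p(Lhs := i))"
    using Visit_basic[of "Atom A" Lhs "p(Lhs := i)"] Atom by simp
  also note match[OF _ Atom]
  finally show ?case by (simp del: fun_upd_apply)
next
  case (AtLeast k R C)
  have "idle (Visit Lhs) (p(Lhs := i)) \<leadsto> idle Match (p(Lhs := i))"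
    using Visit_basic[of "AtLeast k R C" Lhs "p(Lhs := i)"] AtLeast by simp
  also note match[OF _ AtLeast.prems]
  finally show ?case by (simp del: fun_upd_apply)
qed

lemma Visit_Rhs_basic:
  assumes basic: "basic D" "concept_at (tape Rhs) (p Rhs) D"
    and concept: "concept_at (tape Lhs) (p Lhs) C"
    and root: "tape Lhs (p Lhs - 1) \<in> Input ` {LDot, LSub}"
    and body: "\<And>k R C' D' q. D = AtLeast k R D' \<Longrightarrow>
      concept_at (tape Lhs) (q Lhs) C' \<Longrightarrow> concept_at (tape Rhs) (q Rhs) D' \<Longrightarrow>
      tape Lhs (q Lhs - 1) = Input LDot \<Longrightarrow>
      idle (Visit Rhs) q \<leadsto> idle (Return Rhs (struct_subsumed C' D')) q"
  shows "idle (Visit Rhs) p \<leadsto> idle (Return Rhs (struct_subsumed C D)) p"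
proof -
  let ?b = "struct_subsumed C D"
  have match: "idle Match (p(Lhs := j)) \<leadsto> idle (Return Lhs (struct_subsumed E D)) (p(Lhs := j))"
    if "basic E" "concept_at (tape Lhs) j E" for E j
    using that basic by (intro Match_basic body) simp_all
  have "idle (Visit Rhs) p \<leadsto> idle (Visit Lhs) p" using Visit_basic[of D Rhs p] basic by simp
  also have "\<dots> \<leadsto> idle (Return Lhs ?b) p" using Visit_Lhs[OF basic(1) concept, of p] match by simp
  also have "\<dots> \<leadsto> idle (ReturnLeft Lhs ?b) (p(Lhs := p Lhs - 1))"
    using concept_at_hd[OF concept] by (intro reaches_step) (auto simp: step_conf)
  also have "\<dots> \<leadsto> idle (Return Rhs ?b) p"
    using root by (intro reaches_step) (auto simp: step_conf fun_upd_idem)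
  finally show ?thesis .
qed

lemma Visit_Rhs:
  assumes "concept_at (tape Rhs) (p Rhs) D" "concept_at (tape Lhs) (p Lhs) C"
    and "tape Lhs (p Lhs - 1) \<in> Input ` {LDot, LSub}"
  shows "idle (Visit Rhs) p \<leadsto> idle (Return Rhs (struct_subsumed C D)) p"
  using assms
proof (induction D arbitrary: p C)
  case Top
  then show ?case using Visit_Top[of Rhs p] by (simp add: concept_at_def)
next
  case (And D E)
  have "idle (Visit Rhs) (p(Rhs := p Rhs)) \<leadsto> idle (Return Rhs (if struct_subsumed C D = (Rhs = Lhs)
      then struct_subsumed C D else struct_subsumed C E)) (p(Rhs := p Rhs))"
    using And by (intro Visit_And) auto
  then show ?case by (simp split: if_splits)
next
  case (Atom A)
  show ?case by (rule Visit_Rhs_basic[OF _ Atom]) simp_all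
next
  case (AtLeast k R D)
  show ?case
  proof (rule Visit_Rhs_basic[OF _ AtLeast.prems])
    fix l S C' D' q
    assume "AtLeast k R D = AtLeast l S D'" "concept_at (tape Lhs) (q Lhs) C'"
      "concept_at (tape Rhs) (q Rhs) D'" "tape Lhs (q Lhs - 1) = Input LDot"
    then show "idle (Visit Rhs) q \<leadsto> idle (Return Rhs (struct_subsumed C' D')) q"
      using AtLeast.IH by simp
  qed simp
qed

abbreviation start_config :: "letter config" where
  "start_config \<equiv> idle (Visit Rhs) (\<lambda>_. 1)"

lemma reaches_verdict:
  assumes "concept_at (tape Rhs) 1 D" "concept_at (tape Lhs) 1 C" "\<And>s. tape s 0 = Input LSub"
  shows "\<exists>p. start_config \<leadsto> idle (if struct_subsumed C D then Accept else Reject) p"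
proof -
  let ?b = "struct_subsumed C D" and ?p = "(\<lambda>_. 1)(Rhs := 0) :: side \<Rightarrow> int"
  have "start_config \<leadsto> idle (Return Rhs ?b) (\<lambda>_. 1)"
    using assms by (intro Visit_Rhs) simp_all
  also have "\<dots> \<leadsto> idle (ReturnLeft Rhs ?b) ?p"
    using concept_at_hd[OF assms(1)] by (intro reaches_step) (auto simp: step_conf)
  also have "\<dots> \<leadsto> idle (if ?b then Accept else Reject) ?p"
    using assms(3) by (intro reaches_step) (simp add: step_conf)
  finally show ?thesis by blast
qed

end


section \<open>Running time\<close>

context prepared_tapes
begin

definition evaluation_states :: "control set" where
  "evaluation_states = - insert Start (range Copy)"

definition evaluation_configs :: "letter config set" where
  "evaluation_configs = {conf q p h |q p h.
     q \<in> evaluation_states \<and> h \<in> {-1..int n + 1} \<and> (\<forall>s. p s \<in> {-1..int n + 1})}"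

lemma transition_evaluation_states:
  "q \<in> evaluation_states \<Longrightarrow> transition q x z = (q', m, k) \<Longrightarrow> q' \<in> evaluation_states"
  by (cases q) (auto simp: evaluation_states_def split: if_splits)

lemma glide_bounded:
  assumes "h \<notin> {0..int n} \<Longrightarrow> c = Blank" "h \<in> {-1..int n + 1}"
  shows "glide c m h \<in> {-1..int n + 1}"
  using assms by (cases m; cases "h \<in> {0..int n}") (auto simp: glide_def)

lemma step_evaluation_configs:
  assumes "a \<in> evaluation_configs"
  shows "step subsumption_tm a \<in> evaluation_configs"
proof -
  obtain q p h where a_eq: "a = conf q p h" and state: "q \<in> evaluation_states"
    and bounds: "h \<in> {-1..int n + 1}" "\<And>s. p s \<in> {-1..int n + 1}"
    using assms by (auto simp: evaluation_configs_def)
  show ?thesis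
  proof (cases "q \<in> {Accept, Reject}")
    case True
    then have "step subsumption_tm a = a"
      by (auto simp: a_eq conf_def config_def subsumption_tm_def)
    then show ?thesis using assms by simp
  next
    case False
    obtain q' m k where transition: "transition q (\<lambda>s. tape s (p s)) (counter h) = (q', m, k)"
      by (metis prod_cases3)
    have "step subsumption_tm a = conf q' (advance m p) (glide (counter h) k h)"
      using state False transition by (simp add: a_eq step_conf evaluation_states_def image_iff)
    moreover have "glide (counter h) k h \<in> {-1..int n + 1}" "advance m p s \<in> {-1..int n + 1}" for s
      using bounds counter_outside tape_outside unfolding advance_def
      by (blast intro: glide_bounded)+
    ultimately show ?thesis
      unfolding evaluation_configs_def
      using transition_evaluation_states[OF state transition] by blast
  qed
qed

lemma evaluation_configs_card:
  "finite evaluation_configs" "card evaluation_configs \<le> card (UNIV :: control set) * (n + 3) ^ 3"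
proof -
  let ?I = "{-1..int n + 1}"
  let ?conf = "\<lambda>(q, i, j, h). conf q (case_side i j) h"
  have subset: "evaluation_configs \<subseteq> ?conf ` (UNIV \<times> ?I \<times> ?I \<times> ?I)"
  proof
    fix a assume "a \<in> evaluation_configs"
    then obtain q p h where a_eq: "a = conf q p h" and bounds: "h \<in> ?I" "\<And>s. p s \<in> ?I"
      by (auto simp: evaluation_configs_def)
    have "p = case_side (p Lhs) (p Rhs)" by (simp add: fun_eq_iff all_side)
    then have "a = ?conf (q, p Lhs, p Rhs, h)" using a_eq by simp
    then show "a \<in> ?conf ` (UNIV \<times> ?I \<times> ?I \<times> ?I)" using bounds by blast
  qed
  then show "finite evaluation_configs" by (rule finite_subset) simp
  have "card evaluation_configs \<le> card (?conf ` (UNIV \<times> ?I \<times> ?I \<times> ?I))"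
    using subset by (intro card_mono) simp_all
  also have "\<dots> \<le> card ((UNIV :: control set) \<times> ?I \<times> ?I \<times> ?I)" by (intro card_image_le) simp
  also have "\<dots> = card (UNIV :: control set) * (n + 3) ^ 3"
    by (simp add: card_cartesian_product power3_eq_cube nat_add_distrib mult.assoc add.commute)
  finally show "card evaluation_configs \<le> card (UNIV :: control set) * (n + 3) ^ 3" .
qed

lemma reaches_in_evaluation:
  assumes "start_config \<leadsto> a"
  shows "\<exists>t \<le> card (UNIV :: control set) * (n + 3) ^ 3. reaches_in subsumption_tm t start_config a"
proof -
  have "start_config \<in> evaluation_configs"
    unfolding evaluation_configs_def evaluation_states_def by force
  then obtain t where "t \<le> card evaluation_configs" "reaches_in subsumption_tm t start_config a"
    using reaches_in_le_card[OF evaluation_configs_card(1) step_evaluation_configs _ assms] by blast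
  then show ?thesis using evaluation_configs_card(2) le_trans by blast
qed

end

lemma prepared_tapes_copied:
  "prepared_tapes (counter_tape C D) (concept_tapes C D) (csize C + csize D + 1)"
proof
  have length: "length (input_word C D) = csize C + csize D + 1"
    by (simp add: input_word_def csize_def)
  have csize_pos: "csize E > 0" for E by (cases E) simp_all
  fix h :: int and s
  show "counter_tape C D (int (csize C + csize D + 1)) = Work 0" by (simp add: counter_tape_def)
  show "0 \<le> h \<Longrightarrow> h < int (csize C + csize D + 1) \<Longrightarrow> counter_tape C D h \<in> range Input"
    by (simp add: counter_tape_def cells_def length)
  show "h \<notin> {0..int (csize C + csize D + 1)} \<Longrightarrow> counter_tape C D h = Blank"
    by (auto simp: counter_tape_def cells_eq_Blank_iff length)
  show "h \<notin> {0..int (csize C + csize D + 1)} \<Longrightarrow> concept_tapes C D s h = Blank"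
    using csize_pos[of C] csize_pos[of D]
    by (auto simp: concept_tapes_def cells_eq_Blank_iff csize_def)
qed

lemma concept_at_concept_tapes: "concept_at (concept_tapes C D s) 1 (if s = Lhs then C else D)"
  using reads_cells[of "LSub # word_of (if s = Lhs then C else D) @ [LSub]"]
  by (simp add: concept_at_def concept_tapes_def csize_def)

definition time_bound :: "nat poly" where
  "time_bound = [:5, 2:] + smult (card (UNIV :: control set)) ([:4, 1:] ^ 3)"

lemma subsumption_tm_decides:
  "\<exists>t \<le> poly time_bound (csize C + csize D).
     fst ((step subsumption_tm ^^ t) (initial subsumption_tm (input_word C D))) =
       (if struct_subsumed C D then accept subsumption_tm else reject subsumption_tm)"
proof -
  let ?n = "csize C + csize D + 1"
  interpret prepared_tapes "counter_tape C D" "concept_tapes C D" ?n by (rule prepared_tapes_copied)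
  have copying: "reaches_in subsumption_tm (2 * (csize C + csize D) + 5)
      (initial subsumption_tm (input_word C D)) start_config"
    using reaches_in_copying[of C D] by (simp add: conf_def)
  obtain p where "start_config \<leadsto> idle (if struct_subsumed C D then Accept else Reject) p"
    using reaches_verdict[of D C] concept_at_concept_tapes[of C D Lhs]
      concept_at_concept_tapes[of C D Rhs]
    by (auto simp: concept_tapes_def cells_def)
  then obtain t where bound: "t \<le> card (UNIV :: control set) * (?n + 3) ^ 3"
    and evaluation: "reaches_in subsumption_tm t start_config
      (idle (if struct_subsumed C D then Accept else Reject) p)"
    using reaches_in_evaluation by blast
  show ?thesis
  proof (intro exI conjI)
    show "2 * (csize C + csize D) + 5 + t \<le> poly time_bound (csize C + csize D)"
      using bound by (simp add: time_bound_def add_ac)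
    show "fst ((step subsumption_tm ^^ (2 * (csize C + csize D) + 5 + t))
        (initial subsumption_tm (input_word C D))) =
       (if struct_subsumed C D then accept subsumption_tm else reject subsumption_tm)"
      using reaches_in_trans[OF copying evaluation]
      by (simp add: reaches_in_def conf_def config_def subsumption_tm_def)
  qed
qed

theorem theorem8:
  "\<exists>(M :: letter tm) (p :: nat poly). turing_machine M \<and>
     (\<forall>C C'.
        (subsumed C C' \<longrightarrow> accepts_within M (input_word C C') (poly p (csize C + csize C'))) \<and>
        (\<not> subsumed C C' \<longrightarrow> rejects_within M (input_word C C') (poly p (csize C + csize C'))))"
proof (intro exI conjI allI)
  show "turing_machine subsumption_tm" by (rule turing_machine_subsumption_tm)
next
  fix C C'
  from subsumption_tm_decides[of C C'] subsumed_iff_struct_subsumed[of C C']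
  show "subsumed C C' \<longrightarrow>
      accepts_within subsumption_tm (input_word C C') (poly time_bound (csize C + csize C'))"
    and "\<not> subsumed C C' \<longrightarrow>
      rejects_within subsumption_tm (input_word C C') (poly time_bound (csize C + csize C'))"
    unfolding accepts_within_def rejects_within_def by auto
qed

end
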